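(* If $G$ is a triangle-free connected graph with $G\in\mathcal{G}^{\mathrm{cs}}$ and $G$ is not a cycle, then $\mathrm{diam}(G)\le 3$.
   Context: All graphs are finite and simple. A weight function on $V(G)$ is a map $w:V(G)\to\mathbb{R}_{>0}$; for $X\subseteq V(G)$ put $w(X)=\sum_{v\in X}w(v)$. A non-empty set $S\subseteq V(G)$ is a weighted safe set of $(G,w)$ if for every component $C$ of the induced subgraph $G[S]$ and every component $D$ of $G-S$ such that some edge joins $C$ and $D$, we have $w(C)\ge w(D)$. It is a connected weighted safe set if moreover $G[S]$ is connected. $\mathrm{s}(G,w)$ (resp. $\mathrm{cs}(G,w)$) is the minimum of $w(S)$ over all weighted safe sets (resp. connected weighted safe sets) $S$ of $(G,w)$. $\mathcal{G}^{\mathrm{cs}}$ denotes the family of all graphs $G$ such that $\mathrm{s}(G,w)=\mathrm{cs}(G,w)$ for every weight function $w$ on $V(G)$. *)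

theory Defs
  imports "Graph_Theory.Graph_Theory"
begin

text \<open>
  A finite simple graph is a digraph satisfying the library locale \<^locale>\<open>graph\<close>: finite, without
  loops and parallel arcs, and symmetric, so that an edge \<open>uv\<close> is a pair of opposite arcs.
  The induced subgraph \<open>G[S]\<close> is \<open>G \<restriction> S\<close>, and \<open>G - S\<close> is \<open>G \<restriction> (verts G - S)\<close>.
\<close>

definition components :: "('a, 'b) pre_digraph \<Rightarrow> ('a, 'b) pre_digraph set" where
  "components G = {C. pre_digraph.max_subgraph G Digraph_Component.connected C}"

definition weight_function :: "('a, 'b) pre_digraph \<Rightarrow> ('a \<Rightarrow> real) \<Rightarrow> bool" where
  "weight_function G w \<longleftrightarrow> (\<forall>v \<in> verts G. 0 < w v)"

definition weighted_safe_set :: "('a, 'b) pre_digraph \<Rightarrow> ('a \<Rightarrow> real) \<Rightarrow> 'a set \<Rightarrow> bool" where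
  "weighted_safe_set G w S \<longleftrightarrow>
     S \<noteq> {} \<and> S \<subseteq> verts G \<and>
     (\<forall>C \<in> components (G \<restriction> S). \<forall>D \<in> components (G \<restriction> (verts G - S)).
        (\<exists>u \<in> verts C. \<exists>v \<in> verts D. u \<rightarrow>\<^bsub>G\<^esub> v) \<longrightarrow> sum w (verts C) \<ge> sum w (verts D))"

definition connected_weighted_safe_set ::
  "('a, 'b) pre_digraph \<Rightarrow> ('a \<Rightarrow> real) \<Rightarrow> 'a set \<Rightarrow> bool" where
  "connected_weighted_safe_set G w S \<longleftrightarrow>
     weighted_safe_set G w S \<and> Digraph_Component.connected (G \<restriction> S)"

definition safe_number :: "('a, 'b) pre_digraph \<Rightarrow> ('a \<Rightarrow> real) \<Rightarrow> real" where
  "safe_number G w = Min (sum w ` {S. weighted_safe_set G w S})"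

definition connected_safe_number :: "('a, 'b) pre_digraph \<Rightarrow> ('a \<Rightarrow> real) \<Rightarrow> real" where
  "connected_safe_number G w = Min (sum w ` {S. connected_weighted_safe_set G w S})"

definition cs_graphs :: "('a, 'b) pre_digraph set" where
  "cs_graphs = {G. graph G \<and>
     (\<forall>w. weight_function G w \<longrightarrow> safe_number G w = connected_safe_number G w)}"

definition triangle_free :: "('a, 'b) pre_digraph \<Rightarrow> bool" where
  "triangle_free G \<longleftrightarrow> \<not> (\<exists>x y z. x \<rightarrow>\<^bsub>G\<^esub> y \<and> y \<rightarrow>\<^bsub>G\<^esub> z \<and> z \<rightarrow>\<^bsub>G\<^esub> x)"

text \<open>
  The whole graph is a cycle on at least three vertices. The library predicate
  \<^const>\<open>pre_digraph.cycle\<close> is about walks in a digraph, where \<open>a, b, a\<close> is a cycle.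
\<close>

definition is_cycle_graph :: "('a, 'b) pre_digraph \<Rightarrow> bool" where
  "is_cycle_graph G \<longleftrightarrow>
     (\<exists>vs. distinct vs \<and> 3 \<le> length vs \<and> verts G = set vs \<and>
        arcs_ends G = (\<Union>i < length vs. {(vs ! i, vs ! (Suc i mod length vs)),
                                        (vs ! (Suc i mod length vs), vs ! i)}))"

text \<open>\<open>\<mu>\<close> is the infimum of walk costs; unit costs give walk lengths.\<close>

definition graph_dist :: "('a, 'b) pre_digraph \<Rightarrow> 'a \<Rightarrow> 'a \<Rightarrow> ereal" where
  "graph_dist G = wf_digraph.\<mu> G (\<lambda>_. 1)"

definition diam :: "('a, 'b) pre_digraph \<Rightarrow> ereal" where
  "diam G = (SUP u \<in> verts G. SUP v \<in> verts G. graph_dist G u v)"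

text \<open>For a connected graph, the two minima are taken over finite non-empty sets.\<close>

lemma finite_weighted_safe_sets:
  assumes "graph G"
  shows "finite {S. weighted_safe_set G w S}" "finite {S. connected_weighted_safe_set G w S}"
proof -
  interpret graph G by fact
  have "finite (Pow (verts G))" by simp
  then show "finite {S. weighted_safe_set G w S}" "finite {S. connected_weighted_safe_set G w S}"
    by (rule finite_subset[rotated];
        auto simp: weighted_safe_set_def connected_weighted_safe_set_def)+
qed

lemma connected_weighted_safe_set_verts:
  assumes "graph G" "Digraph_Component.connected G"
  shows "connected_weighted_safe_set G w (verts G)"
proof -
  interpret graph G by fact
  have G: "G \<restriction> verts G = G"
    by (rule pre_digraph.equality) (auto simp: induce_subgraph_def)
  have ne: "verts G \<noteq> {}"
    using assms(2) by (auto simp: connected_def strongly_connected_def mk_symmetric_def)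
  have "components (G \<restriction> {}) = {}"
    by (auto simp: components_def pre_digraph.max_subgraph_def subgraph_def
        connected_def strongly_connected_def mk_symmetric_def)
  then show ?thesis
    using assms(2) ne by (simp add: connected_weighted_safe_set_def weighted_safe_set_def G)
qed

end

theory Submission
  imports Defs
begin

text \<open>
  If \<open>s = cs\<close> for all weights, then any weighted safe set \<open>S\<close> is matched by a connected set \<open>T\<close> of at
  most the same weight such that no connected set avoiding \<open>T\<close> is heavier than \<open>T\<close>. Suitable weights
  rule out two configurations: (P) two disjoint, non-adjacent connected sets each of which separates
  the graph; (Q) a connected set \<open>A\<close> whose complement is a vertex \<open>b\<close> with no neighbour in \<open>A\<close> together
  with an independent set of at least three vertices, two of which are adjacent to both \<open>b\<close> and \<open>A\<close>.

  Let \<open>a\<close>, \<open>e\<close> be at distance at least four. The closed neighbourhoods \<open>N[a]\<close>, \<open>N[e]\<close> are disjoint and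
  non-adjacent, so by (P) one of them, say \<open>N[a]\<close>, contains no connected separator. By (Q) with
  \<open>b = a\<close>, the vertex \<open>a\<close> has degree two, and every non-cut vertex of \<open>R = V - N[a]\<close> is adjacent to
  \<open>N(a)\<close>. The latter implies that no connected subset of \<open>R\<close> separates the graph, because a component
  that it cuts off would contain a non-cut vertex of \<open>R\<close> far from \<open>N(a)\<close>. Hence \<open>e\<close> has the same
  properties as \<open>a\<close>. Applied at \<open>e\<close>, this shows that \<open>V - N[x]\<close> is connected for each neighbour \<open>x\<close>
  of \<open>a\<close>, so \<open>x\<close> has degree two by (Q). Then \<open>R\<close> has at most two non-cut vertices, so it is a path and
  the graph is a cycle.
\<close>

section \<open>Connected vertex sets\<close>

locale fin_graph =
  fixes V :: "'a set" and E :: "('a \<times> 'a) set"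
  assumes finite_V: "finite V"
    and E_subset: "E \<subseteq> V \<times> V"
    and E_sym: "(u, v) \<in> E \<Longrightarrow> (v, u) \<in> E"
    and E_irrefl: "(v, v) \<notin> E"
begin

text \<open>For \<open>K \<subseteq> S\<close> this says that \<open>K\<close> is a union of
  components of the graph induced on \<open>S\<close>. \<open>K\<close> may also reach outside
  \<open>S\<close>, so that a closed set can be tested against smaller \<open>S\<close>.\<close>

definition closed_in :: "'a set \<Rightarrow> 'a set \<Rightarrow> bool" where
  "closed_in K S \<longleftrightarrow> (\<forall>u \<in> K. \<forall>v \<in> S. (u, v) \<in> E \<longrightarrow> v \<in> K)"

text \<open>Connectedness by cuts instead of walks, since most arguments below show that a closed
  part is everything.\<close>

definition conn :: "'a set \<Rightarrow> bool" where
  "conn S \<longleftrightarrow> S \<noteq> {} \<and> (\<forall>U. U \<subseteq> S \<longrightarrow> U \<noteq> {} \<longrightarrow> closed_in U S \<longrightarrow> U = S)"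

definition is_comp :: "'a set \<Rightarrow> 'a set \<Rightarrow> bool" where
  "is_comp K S \<longleftrightarrow> K \<subseteq> S \<and> conn K \<and> closed_in K S"

definition safe :: "('a \<Rightarrow> real) \<Rightarrow> 'a set \<Rightarrow> bool" where
  "safe w S \<longleftrightarrow> S \<noteq> {} \<and> S \<subseteq> V \<and>
     (\<forall>K L. is_comp K S \<longrightarrow> is_comp L (V - S) \<longrightarrow> (\<exists>u \<in> K. \<exists>v \<in> L. (u, v) \<in> E) \<longrightarrow>
        sum w L \<le> sum w K)"

definition nbh :: "'a \<Rightarrow> 'a set" where
  "nbh a = {v. (a, v) \<in> E}"

definition ball :: "'a \<Rightarrow> 'a set" where
  "ball a = insert a (nbh a)"

lemma E_in_V: "(u, v) \<in> E \<Longrightarrow> u \<in> V" "(u, v) \<in> E \<Longrightarrow> v \<in> V"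
  using E_subset by auto

lemma nbh_subset: "nbh a \<subseteq> V"
  using E_subset by (auto simp: nbh_def)

lemma conn_ne: "conn S \<Longrightarrow> S \<noteq> {}"
  by (simp add: conn_def)

lemma conn_closed_eq: "conn S \<Longrightarrow> U \<subseteq> S \<Longrightarrow> U \<noteq> {} \<Longrightarrow> closed_in U S \<Longrightarrow> U = S"
  by (simp add: conn_def)

text \<open>\<open>L \<inter> K\<close> is closed in \<open>L\<close>, hence all of
  \<open>L\<close>. Most component arguments below rest on this.\<close>

lemma conn_subset_closed:
  assumes "conn L" "closed_in K S" "L \<subseteq> S" "L \<inter> K \<noteq> {}"
  shows "L \<subseteq> K"
proof -
  have "closed_in (L \<inter> K) L"
    using assms(2,3) by (auto simp: closed_in_def)
  then have "L \<inter> K = L"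
    using assms by (intro conn_closed_eq) auto
  then show ?thesis by auto
qed

lemma conn_singleton: "conn {v}"
  by (auto simp: conn_def)

lemma conn_insert:
  assumes "conn A" "u \<in> A" "(u, v) \<in> E"
  shows "conn (insert v A)"
  unfolding conn_def
proof (intro conjI allI impI)
  fix U assume U: "U \<subseteq> insert v A" "U \<noteq> {}" "closed_in U (insert v A)"
  have "U \<inter> A \<noteq> {}"
  proof
    assume "U \<inter> A = {}"
    with U(1,2) have "v \<in> U" by auto
    with U(3) assms(2,3) have "u \<in> U" by (auto simp: closed_in_def dest: E_sym)
    with \<open>U \<inter> A = {}\<close> assms(2) show False by auto
  qed
  moreover have "closed_in U A" using U(3) by (auto simp: closed_in_def)
  ultimately have "A \<subseteq> U"
    using conn_subset_closed[OF assms(1), of U A] by auto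
  moreover from this have "v \<in> U"
    using U(3) assms(2,3) by (auto simp: closed_in_def)
  ultimately show "U = insert v A" using U(1) by auto
qed auto

lemma conn_attach:
  assumes "finite X" "conn A" "\<And>v. v \<in> X \<Longrightarrow> \<exists>u \<in> A. (u, v) \<in> E"
  shows "conn (A \<union> X)"
  using assms
proof (induction X rule: finite_induct)
  case (insert v X)
  then obtain u where "u \<in> A" "(u, v) \<in> E" by auto
  with insert conn_insert[of "A \<union> X" u v] show ?case by auto
qed simp

lemma conn_Un:
  assumes "conn A" "conn B" "u \<in> A" "v \<in> B" "(u, v) \<in> E"
  shows "conn (A \<union> B)"
  unfolding conn_def
proof (intro conjI allI impI)
  fix U assume U: "U \<subseteq> A \<union> B" "U \<noteq> {}" "closed_in U (A \<union> B)"
  have cl: "closed_in U A" "closed_in U B" using U(3) by (auto simp: closed_in_def)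
  have A: "A \<subseteq> U" if "A \<inter> U \<noteq> {}" by (rule conn_subset_closed[OF assms(1) cl(1) subset_refl that])
  have B: "B \<subseteq> U" if "B \<inter> U \<noteq> {}" by (rule conn_subset_closed[OF assms(2) cl(2) subset_refl that])
  have "u \<in> U \<longleftrightarrow> v \<in> U"
    using U(3) assms(3-5) E_sym[OF assms(5)] by (auto simp: closed_in_def)
  then show "U = A \<union> B" using A B U(1,2) assms(3,4) by blast
qed (use assms in auto)

lemma conn_star: "X \<subseteq> nbh a \<Longrightarrow> conn (insert a X)"
  using conn_attach[OF _ conn_singleton, of X a] finite_subset[OF subset_trans[OF _ nbh_subset] finite_V]
  by (auto simp: nbh_def)

lemma conn_ball: "conn (ball a)"
  by (simp add: ball_def conn_star)

section \<open>Components and non-cut vertices\<close>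

lemma comp_exists:
  assumes "u \<in> S"
  shows "\<exists>K. u \<in> K \<and> is_comp K S"
proof -
  \<comment> \<open>The vertices reachable from \<open>u\<close> inside \<open>S\<close>. A closed
    part of \<open>K\<close> contains all of it or nothing, according to whether it contains
    \<open>u\<close>.\<close>
  define K where "K = {v. (u, v) \<in> (E \<inter> S \<times> S)\<^sup>*}"
  have "K \<subseteq> S"
  proof
    fix v assume "v \<in> K"
    then have "(u, v) \<in> (E \<inter> S \<times> S)\<^sup>*" by (simp add: K_def)
    then show "v \<in> S" using assms by induction auto
  qed
  moreover have cl: "closed_in K S"
    using \<open>K \<subseteq> S\<close> by (auto simp: closed_in_def K_def intro: rtrancl_into_rtrancl)
  moreover have "conn K"
    unfolding conn_def
  proof (intro conjI allI impI)
    show "K \<noteq> {}" by (auto simp: K_def)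
    fix U assume U: "U \<subseteq> K" "U \<noteq> {}" "closed_in U K"
    have iff: "u' \<in> U \<longleftrightarrow> v' \<in> U" if "u' \<in> K" "v' \<in> K" "(u', v') \<in> E" for u' v'
      using that U(3) E_sym[OF that(3)] by (auto simp: closed_in_def)
    have all: "v \<in> K \<and> (u \<in> U \<longleftrightarrow> v \<in> U)" if "(u, v) \<in> (E \<inter> S \<times> S)\<^sup>*" for v
      using that
    proof induction
      case base then show ?case by (auto simp: K_def)
    next
      case (step y z)
      then have "z \<in> K" using cl by (auto simp: closed_in_def)
      then show ?case using step iff by blast
    qed
    then have "u \<in> U" using U(1,2) by (auto simp: K_def)
    then show "U = K" using all U(1) by (auto simp: K_def)
  qed
  ultimately show ?thesis by (auto simp: is_comp_def K_def intro!: exI[of _ K])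
qed

lemma conn_imp_rtrancl:
  assumes "conn S" "u \<in> S" "v \<in> S"
  shows "(u, v) \<in> (E \<inter> S \<times> S)\<^sup>*"
proof -
  define K where "K = {v \<in> S. (u, v) \<in> (E \<inter> S \<times> S)\<^sup>*}"
  have "closed_in K S"
    by (auto simp: closed_in_def K_def intro: rtrancl_into_rtrancl)
  then have "K = S"
    using assms by (intro conn_closed_eq) (auto simp: K_def)
  then show ?thesis using assms(3) by (auto simp: K_def)
qed

text \<open>The component around \<open>K\<close> is not all of \<open>S\<close>, so a second one
  exists.\<close>

lemma not_conn_other_comp:
  assumes "\<not> conn S" "conn K" "K \<subseteq> S"
  shows "\<exists>C. is_comp C S \<and> C \<inter> K = {}"
proof -
  obtain k where k: "k \<in> K" using conn_ne[OF assms(2)] by auto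
  then obtain B where B: "k \<in> B" "is_comp B S" using comp_exists assms(3) by blast
  have "K \<subseteq> B"
    using conn_subset_closed[OF assms(2), of B S] B k assms(3) by (auto simp: is_comp_def)
  have "B \<noteq> S" using B(2) assms(1) by (auto simp: is_comp_def)
  then obtain c where c: "c \<in> S" "c \<notin> B" using B(2) by (auto simp: is_comp_def)
  obtain C where C: "c \<in> C" "is_comp C S" using comp_exists c(1) by blast
  have "C \<inter> B = {}"
    using conn_subset_closed[of C B S] B(2) C c(2) by (auto simp: is_comp_def)
  then show ?thesis using C(2) \<open>K \<subseteq> B\<close> by blast
qed

text \<open>Take a maximal connected \<open>K'\<close> between \<open>K\<close> and
  \<open>M\<close>, different from \<open>M\<close>. Adding any neighbour of \<open>K'\<close> in
  \<open>M\<close> must already give \<open>M\<close>, and that neighbour is the vertex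
  sought.\<close>

lemma exists_noncut_vertex:
  assumes "finite M" "conn M" "conn K" "K \<subset> M"
  shows "\<exists>z \<in> M - K. conn (M - {z})"
proof -
  let ?F = "{K'. K \<subseteq> K' \<and> K' \<subset> M \<and> conn K'}"
  have "finite ?F" using assms(1) by (auto intro: finite_subset[of _ "Pow M"])
  moreover have "K \<in> ?F" using assms by auto
  ultimately obtain K' where K': "K' \<in> ?F" "\<And>L. L \<in> ?F \<Longrightarrow> K' \<subseteq> L \<Longrightarrow> K' = L"
    using finite_has_maximal[of ?F] by (metis (no_types, lifting) empty_iff)
  have "\<not> closed_in K' M"
    using conn_closed_eq[OF assms(2), of K'] K'(1) conn_ne by auto
  then obtain u v where uv: "u \<in> K'" "v \<in> M" "v \<notin> K'" "(u, v) \<in> E"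
    by (auto simp: closed_in_def)
  have "conn (insert v K')" using K'(1) uv conn_insert by auto
  then have "insert v K' = M"
    using K'(2)[of "insert v K'"] K'(1) uv by blast
  then have "M - {v} = K'" using uv(3) by auto
  then show ?thesis using uv K'(1) by auto
qed

text \<open>Within \<open>M\<close>, edges leaving \<open>W\<close> end in \<open>F\<close>, hence
  in the component \<open>K\<close> of \<open>M - W\<close> around \<open>F\<close>. So
  \<open>K \<union> W\<close> is closed in \<open>M\<close>, and there is no other
  component.\<close>

lemma conn_Diff:
  assumes "conn M" "conn F" "F \<subseteq> M - W" "W \<subseteq> M" "closed_in W (M - F)"
  shows "conn (M - W)"
proof -
  obtain f where f: "f \<in> F" using conn_ne[OF assms(2)] by auto
  then obtain K where K: "f \<in> K" "is_comp K (M - W)" using comp_exists assms(3) by blast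
  have "F \<subseteq> K"
    using conn_subset_closed[OF assms(2), of K "M - W"] K f assms(3) by (auto simp: is_comp_def)
  have "closed_in (K \<union> W) M"
    using K(2) assms(5) \<open>F \<subseteq> K\<close> by (auto simp: closed_in_def is_comp_def)
  then have "K \<union> W = M"
    using conn_closed_eq[OF assms(1), of "K \<union> W"] K assms(4) by (auto simp: is_comp_def)
  then have "M - W = K" using K(2) by (auto simp: is_comp_def)
  then show ?thesis using K(2) by (simp add: is_comp_def)
qed

end

section \<open>Two forbidden configurations\<close>

text \<open>The form in which s = cs enters. Since the graph is connected, every component of
  \<open>V - T\<close> is adjacent to \<open>T\<close>, and a connected \<open>L\<close> lies in one
  of them; so safety bounds all connected sets avoiding \<open>T\<close>.\<close>

locale cs_fin_graph = fin_graph +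
  assumes conn_V: "conn V"
    and light_connected_set: "\<lbrakk>\<And>v. v \<in> V \<Longrightarrow> 0 < w v; safe w S\<rbrakk> \<Longrightarrow>
      \<exists>T \<subseteq> V. conn T \<and> sum w T \<le> sum w S \<and>
        (\<forall>L \<subseteq> V - T. conn L \<longrightarrow> sum w L \<le> sum (w :: 'a \<Rightarrow> real) T)"
begin

text \<open>
  The edges \<open>ac\<close> and \<open>bd\<close> carry weight about 1 at each end. All other vertices are light, those outside
  \<open>A \<union> B \<union> C \<union> D\<close> being much heavier than those inside: a connected set joining the two heavy edges
  then costs more than the safe set \<open>A \<union> B\<close>.
\<close>

lemma no_two_pendant_sets:
  assumes conn: "conn A" "conn B" "conn C" "conn D"
    and sub: "A \<subseteq> V" "B \<subseteq> V" "C \<subseteq> V" "D \<subseteq> V"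
    and disj: "A \<inter> B = {}" "A \<inter> C = {}" "A \<inter> D = {}" "B \<inter> C = {}" "B \<inter> D = {}" "C \<inter> D = {}"
    and AB: "\<And>u v. u \<in> A \<Longrightarrow> v \<in> B \<Longrightarrow> (u, v) \<notin> E"
    and C: "closed_in C (V - A)" and D: "closed_in D (V - B)"
    and ac: "a \<in> A" "c \<in> C" "(a, c) \<in> E"
    and bd: "b \<in> B" "d \<in> D" "(b, d) \<in> E"
  shows False
proof -
  \<comment> \<open>All vertices of weight at most \<open>s\<close> together weigh at most
    \<open>n * s = 1 / 4\<close>, those of weight \<open>t\<close> at most
    \<open>n * t = s / 4\<close>. The deficit \<open>n * t\<close> at \<open>c\<close> and
    \<open>d\<close> pays for the light vertices of \<open>C\<close> and \<open>D\<close>, so that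
    each of these sets weighs at most 1.\<close>
  define n where "n = real (card V)"
  define s where "s = 1 / (4 * n)"
  define t where "t = 1 / (16 * n * n)"
  define w where "w v = (if v = a \<or> v = b then 1 else if v = c \<or> v = d then 1 - n * t
    else if v \<in> A \<union> B \<union> C \<union> D then t else s)" for v
  have ne: "a \<noteq> b" "a \<noteq> c" "a \<noteq> d" "b \<noteq> c" "b \<noteq> d" "c \<noteq> d"
    using ac bd disj by auto
  have wh: "w a = 1" "w b = 1" "w c = 1 - n * t" "w d = 1 - n * t"
    using ne by (auto simp: w_def)
  have "card V \<noteq> 0" using ac(1) sub(1) finite_V by auto
  then have n1: "1 \<le> n" by (simp add: n_def)
  have s0: "0 < s" "n * s = 1 / 4" "s \<le> 1 / 4"
    using n1 by (auto simp: s_def field_simps)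
  have t0: "0 < t" "4 * (n * t) = s" using n1 by (auto simp: t_def s_def field_simps)
  have nt: "n * t \<le> 1 / 16" using t0(2) s0(3) by linarith
  have tn: "t \<le> n * t" using n1 t0(1) by simp
  have t1: "t \<le> 1" using tn nt by linarith
  have pos: "0 < w v" for v using s0 t0(1) nt by (auto simp: w_def)
  have fin: "finite X" if "X \<subseteq> V" for X using that finite_V finite_subset by auto
  have small: "sum w X \<le> n * r" if "X \<subseteq> V" "\<And>v. v \<in> X \<Longrightarrow> w v \<le> r" "0 \<le> r" for X r
  proof -
    have "sum w X \<le> card X * r" using sum_bounded_above[of X w r] that by simp
    also have "\<dots> \<le> n * r"
      using that(1,3) card_mono[OF finite_V that(1)] by (simp add: n_def mult_right_mono)
    finally show ?thesis .
  qed
  have split: "sum w X = w v + sum w (X - {v})" if "X \<subseteq> V" "v \<in> X" for X v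
    using that fin sum.remove[of X v w] by auto
  have mono: "sum w X \<le> sum w Y" if "X \<subseteq> Y" "Y \<subseteq> V" for X Y
    using that fin pos by (intro sum_mono2) (auto intro: less_imp_le)
  have wC: "sum w C \<le> 1"
  proof -
    have "sum w (C - {c}) \<le> n * t"
      using sub disj ac bd t0(1) by (intro small) (auto simp: w_def)
    then show ?thesis using split[of C c] sub ac wh by auto
  qed
  have wD: "sum w D \<le> 1"
  proof -
    have "sum w (D - {d}) \<le> n * t"
      using sub disj ac bd t0(1) by (intro small) (auto simp: w_def)
    then show ?thesis using split[of D d] sub bd wh by auto
  qed
  have wS: "sum w (A \<union> B) \<le> 2 + n * t"
  proof -
    have "sum w (A \<union> B - {a} - {b}) \<le> n * t"
      using sub disj ac bd t0(1) by (intro small) (auto simp: w_def)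
    moreover have "sum w (A \<union> B) = w a + sum w (A \<union> B - {a})"
      using sub ac by (intro split) auto
    moreover have "sum w (A \<union> B - {a}) = w b + sum w (A \<union> B - {a} - {b})"
      using sub bd ne by (intro split) auto
    ultimately show ?thesis using wh by simp
  qed
  have "safe w (A \<union> B)"
    unfolding safe_def
  proof (intro conjI allI impI)
    fix K L assume K: "is_comp K (A \<union> B)" and L: "is_comp L (V - (A \<union> B))"
    have Lconn: "conn L" "L \<subseteq> V - A" "L \<subseteq> V - B" using L by (auto simp: is_comp_def)
    \<comment> \<open>A component containing \<open>c\<close> or \<open>d\<close> is trapped in
      \<open>C\<close> or \<open>D\<close>; any other one has only light vertices.\<close>
    have "sum w L \<le> 1"
    proof (cases "c \<in> L \<or> d \<in> L")
      case True
      then show ?thesis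
      proof
        assume "c \<in> L"
        then have "L \<subseteq> C" using conn_subset_closed[OF Lconn(1) C Lconn(2)] ac by auto
        then show ?thesis using mono[of L C] sub wC by auto
      next
        assume "d \<in> L"
        then have "L \<subseteq> D" using conn_subset_closed[OF Lconn(1) D Lconn(3)] bd by auto
        then show ?thesis using mono[of L D] sub wD by auto
      qed
    next
      case False
      then have "w v \<le> s" if "v \<in> L" for v
        using that Lconn ac bd tn t0 s0 by (auto simp: w_def)
      then have "sum w L \<le> n * s" using Lconn s0 by (intro small) auto
      then show ?thesis using s0 by simp
    qed
    moreover have "1 \<le> sum w K"
    proof -
      have cl: "closed_in K A" "closed_in K B" using K by (auto simp: closed_in_def is_comp_def)
      have "K \<noteq> {}" "K \<subseteq> A \<union> B" using K conn_ne by (auto simp: is_comp_def)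
      then have "A \<subseteq> K \<or> B \<subseteq> K"
        using conn_subset_closed[OF conn(1) cl(1)] conn_subset_closed[OF conn(2) cl(2)] by blast
      then have "a \<in> K \<or> b \<in> K" using ac bd by auto
      then have "sum w {a} \<le> sum w K \<or> sum w {b} \<le> sum w K"
        using mono[of _ K] \<open>K \<subseteq> A \<union> B\<close> sub by (metis empty_subsetI insert_subset subset_trans Un_least)
      then show ?thesis using wh by auto
    qed
    ultimately show "sum w L \<le> sum w K" by simp
  qed (use ac sub in auto)
  then obtain T where T: "T \<subseteq> V" "conn T" "sum w T \<le> sum w (A \<union> B)"
    and heavy: "\<And>L. L \<subseteq> V - T \<Longrightarrow> conn L \<Longrightarrow> sum w L \<le> sum w T"
    using light_connected_set[of w "A \<union> B"] pos by blast
  have nbr: "\<exists>u \<in> X. \<exists>m \<in> V - X. (u, m) \<in> E" if "X \<subseteq> V" "X \<noteq> {}" "X \<noteq> V" for X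
    using conn_closed_eq[OF conn_V, of X] that by (auto simp: closed_in_def)
  \<comment> \<open>Edges leaving \<open>C\<close> end in \<open>A\<close>, edges leaving
    \<open>D\<close> end in \<open>B\<close>, and \<open>A\<close> and \<open>B\<close> are not
    adjacent.\<close>
  have sep: "(u, v) \<notin> E" if "u \<in> A \<union> C" "v \<in> B \<union> D" for u v
  proof
    assume uv: "(u, v) \<in> E"
    have vu: "(v, u) \<in> E" by (rule E_sym[OF uv])
    have inV: "u \<in> V" "v \<in> V" using E_in_V[OF uv] by auto
    have C': "v \<in> A \<union> C" if "u \<in> C" using C that uv inV by (auto simp: closed_in_def)
    have D': "u \<in> B \<union> D" if "v \<in> D" using D that vu inV by (auto simp: closed_in_def)
    show False
      using that C' D' AB[of u v] uv disj by auto
  qed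
  show False
  proof (cases "T \<subseteq> A \<union> B \<union> C \<union> D")
    case True
    \<comment> \<open>\<open>T\<close> lies on one side, so the other side \<open>X\<close> together
      with an outside neighbour \<open>m\<close> avoids \<open>T\<close>. Its weight is at least
      \<open>2 - n * t + s\<close>, which exceeds the bound \<open>2 + n * t\<close> on
      \<open>sum w T\<close> because \<open>s = 4 * (n * t)\<close>.\<close>
    have "closed_in (A \<union> C) (A \<union> B \<union> C \<union> D)" using sep by (auto simp: closed_in_def)
    moreover have "closed_in (B \<union> D) (A \<union> B \<union> C \<union> D)" using sep by (auto simp: closed_in_def dest: E_sym)
    ultimately have "T \<subseteq> A \<union> C \<or> T \<subseteq> B \<union> D"
      using True conn_subset_closed[OF T(2)] conn_ne[OF T(2)] by blast
    then obtain X p q where X: "X \<subseteq> V - T" "conn X" "X = A \<union> C \<and> p = a \<and> q = c \<or> X = B \<union> D \<and> p = b \<and> q = d"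
    proof
      assume "T \<subseteq> A \<union> C"
      then have "B \<union> D \<subseteq> V - T" using sub disj by auto
      then show thesis using that[of "B \<union> D" b d] conn_Un[OF conn(2,4) bd] by simp
    next
      assume "T \<subseteq> B \<union> D"
      then have "A \<union> C \<subseteq> V - T" using sub disj by auto
      then show thesis using that[of "A \<union> C" a c] conn_Un[OF conn(1,3) ac] by simp
    qed
    have "X \<noteq> V" using X(1) T(1) conn_ne[OF T(2)] by auto
    then obtain u m where m: "u \<in> X" "m \<in> V - X" "(u, m) \<in> E"
      using nbr[of X] X(1) conn_ne[OF X(2)] by auto
    have m': "m \<notin> A \<union> B \<union> C \<union> D"
      using X(3) m sep[of u m] sep[of m u] E_sym[OF m(3)] by auto
    have wm: "w m = s" using m' ac bd by (auto simp: w_def)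
    have pq: "p \<in> X" "q \<in> X" "p \<noteq> q" "w p + w q = 2 - n * t"
      using X(3) ac bd ne wh by auto
    have "p \<noteq> m" "q \<noteq> m" using pq m by auto
    have "sum w {p, q, m} \<le> sum w (insert m X)"
      using pq X(1) m by (intro mono) auto
    moreover have "sum w {p, q, m} = 2 - n * t + s"
      using pq m wm \<open>p \<noteq> m\<close> \<open>q \<noteq> m\<close> by simp
    moreover have "sum w (insert m X) \<le> sum w T"
      using X(1) m(2) m' True conn_insert[OF X(2) m(1,3)] by (intro heavy) auto
    ultimately show False using T(3) wS t0 s0 by linarith
  next
    case False
    then obtain m where m: "m \<in> T" "m \<notin> A \<union> B \<union> C \<union> D" by auto
    have wm: "w m = s" using m ac bd by (auto simp: w_def)
    \<comment> \<open>Two heavy vertices and \<open>m\<close> weigh at least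
      \<open>2 - 2 * n * t + s\<close>, again more than \<open>2 + n * t\<close>.\<close>
    have two: False if pq: "p \<in> T" "q \<in> T" "p \<noteq> q" "p \<in> {a, b, c, d}" "q \<in> {a, b, c, d}" for p q
    proof -
      have "p \<noteq> m" "q \<noteq> m" using pq m ac bd by auto
      have "sum w {p, q, m} \<le> sum w T" using pq m T(1) by (intro mono) auto
      moreover have "sum w {p, q, m} = w p + w q + s" using pq wm \<open>p \<noteq> m\<close> \<open>q \<noteq> m\<close> by simp
      moreover have "1 - n * t \<le> w p" "1 - n * t \<le> w q" using pq n1 t0 wh by auto
      ultimately show False using T(3) wS t0 s0 by linarith
    qed
    have rest: "sum w (T - {p}) \<le> 1 / 4" if "T \<inter> {a, b, c, d} \<subseteq> {p}" for p
    proof -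
      have "w v \<le> s" if "v \<in> T - {p}" for v
        using that \<open>T \<inter> {a, b, c, d} \<subseteq> {p}\<close> tn t0 s0 by (auto simp: w_def)
      then have "sum w (T - {p}) \<le> n * s" using T s0 by (intro small) auto
      then show ?thesis using s0 by simp
    qed
    have "\<exists>p. T \<inter> {a, b, c, d} \<subseteq> {p}" using two by blast
    then obtain p where p: "T \<inter> {a, b, c, d} \<subseteq> {p}" by blast
    have w1: "w p \<le> 1" using n1 t1 t0 s0 by (auto simp: w_def)
    \<comment> \<open>With at most one heavy vertex \<open>T\<close> is too light: it misses one of
      the heavy edges entirely, and that edge weighs \<open>2 - n * t\<close>.\<close>
    have "sum w T \<le> 5 / 4"
    proof (cases "p \<in> T")
      case True then show ?thesis using split[OF T(1) True] rest[OF p] w1 by simp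
    next
      case False
      then have "T - {p} = T" by auto
      then show ?thesis using rest[OF p] by simp
    qed
    moreover have "{a, c} \<subseteq> V - T \<or> {b, d} \<subseteq> V - T"
      using p ac bd sub ne by auto
    moreover have "conn {a, c}" "conn {b, d}"
      using conn_insert[OF conn_singleton, of a a c] conn_insert[OF conn_singleton, of b b d] ac bd
      by (auto simp: insert_commute)
    moreover have "sum w {a, c} = 2 - n * t" "sum w {b, d} = 2 - n * t"
      using ne wh by auto
    ultimately show False using heavy[of "{a, c}"] heavy[of "{b, d}"] nt by fastforce
  qed
qed

text \<open>Configuration (P). The pendant sets \<open>C\<close> and \<open>D\<close> are components
  cut off by \<open>A\<close> and by \<open>B\<close> that do not meet the other separator.\<close>

lemma conn_separators_touch:
  assumes "conn A" "conn B" "A \<subseteq> V" "B \<subseteq> V" "A \<inter> B = {}"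
    and AB: "\<And>u v. u \<in> A \<Longrightarrow> v \<in> B \<Longrightarrow> (u, v) \<notin> E"
    and nA: "\<not> conn (V - A)" and nB: "\<not> conn (V - B)"
  shows False
proof -
  obtain C where C: "is_comp C (V - A)" "C \<inter> B = {}"
    using not_conn_other_comp[OF nA assms(2)] assms by blast
  obtain D where D: "is_comp D (V - B)" "D \<inter> A = {}"
    using not_conn_other_comp[OF nB assms(1)] assms by blast
  have touch: "\<exists>a \<in> K. \<exists>c \<in> L. (a, c) \<in> E" if "is_comp L (V - K)" "K \<subseteq> V" "conn K" for K L
  proof -
    have L: "L \<subseteq> V" "L \<noteq> {}" "L \<noteq> V"
      using that conn_ne[of L] conn_ne[of K] by (auto simp: is_comp_def)
    then have "\<not> closed_in L V" using conn_closed_eq[OF conn_V, of L] by auto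
    then obtain c a where "c \<in> L" "a \<in> V" "a \<notin> L" "(c, a) \<in> E" by (auto simp: closed_in_def)
    moreover from this have "a \<in> K" using that(1) by (auto simp: is_comp_def closed_in_def)
    ultimately show ?thesis by (auto dest: E_sym)
  qed
  obtain a c where ac: "a \<in> A" "c \<in> C" "(a, c) \<in> E" using touch[OF C(1)] assms by blast
  obtain b d where bd: "b \<in> B" "d \<in> D" "(b, d) \<in> E" using touch[OF D(1)] assms by blast
  \<comment> \<open>An overlap would put the connected set \<open>C\<close> inside \<open>D\<close>;
    the neighbour \<open>a\<close> of \<open>C\<close> would then lie in \<open>D\<close> as well,
    although \<open>D\<close> avoids \<open>A\<close>.\<close>
  have "C \<inter> D = {}"
  proof (rule ccontr)
    assume "C \<inter> D \<noteq> {}"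
    moreover have "C \<subseteq> V - B" using C by (auto simp: is_comp_def)
    ultimately have "C \<subseteq> D"
      using conn_subset_closed[of C D "V - B"] C D by (auto simp: is_comp_def)
    then have "a \<in> D"
      using ac D(1) E_sym[OF ac(3)] assms(3,5) unfolding is_comp_def closed_in_def by blast
    then show False using D(2) ac by auto
  qed
  moreover have "C \<subseteq> V - A" "conn C" "closed_in C (V - A)" "D \<subseteq> V - B" "conn D" "closed_in D (V - B)"
    using C(1) D(1) by (auto simp: is_comp_def)
  ultimately show False
    using C(2) D(2) assms(3-5)
    by (intro no_two_pendant_sets[OF assms(1,2) _ _ _ _ _ _ _ _ _ _ _ _ AB _ _ ac bd]) auto
qed

text \<open>
  The safe set is \<open>A \<union> {b}\<close>, where \<open>b\<close> has weight \<open>\<beta>\<close>, \<open>A\<close> has total weight 1 spread uniformly, and the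
  remaining vertices have weight \<open>\<mu>\<close>. The numerical assumptions exclude the possible light sets case by case.
\<close>

lemma no_light_star_weights:
  fixes \<beta> \<mu> :: real
  assumes A: "conn A" "A \<subseteq> V" "b \<notin> A" and b: "b \<in> V"
    and I: "I = V - A - {b}"
    and bA: "\<And>v. v \<in> A \<Longrightarrow> (b, v) \<notin> E"
    and indep: "\<And>u v. u \<in> I \<Longrightarrow> v \<in> I \<Longrightarrow> (u, v) \<notin> E"
    and IA: "IA = {i \<in> I. \<exists>a \<in> A. (a, i) \<in> E}" and Ib: "Ib = {i \<in> I. (b, i) \<in> E}"
    and t: "t = 1 / real (card A)"
    and m: "\<mu> \<le> 1" "\<mu> \<le> \<beta>" "1 < \<mu> + t" "1 < 2 * \<mu>" "1 + \<beta> < 2 * \<mu> + t"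
    and mA: "\<beta> + \<mu> < 1 + \<mu> * (real (card IA) - 1)"
    and mb: "1 + \<mu> < \<beta> + \<mu> * (real (card Ib) - 1)"
  shows False
proof -
  \<comment> \<open>Uniform weight on \<open>A\<close> makes a set pay at least \<open>t\<close> as
    soon as it meets \<open>A\<close>, and at most 1 there in total.\<close>
  define w where "w v = (if v = b then \<beta> else if v \<in> A then t else \<mu>)" for v
  have fin: "finite X" if "X \<subseteq> V" for X using that finite_V finite_subset by auto
  have fI: "finite I" and fA: "finite A" using fin I A(2) by auto
  have bI: "b \<notin> I" and AI: "A \<inter> I = {}" using I by auto
  have cA: "0 < card A" using conn_ne[OF A(1)] fA by (simp add: card_gt_0_iff)
  have t0: "0 < t" and tA: "t * card A = 1" using cA by (auto simp: t)
  have pos: "0 < w v" for v using t0 m by (auto simp: w_def)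
  have wsum: "sum w X = (if b \<in> X then \<beta> else 0) + t * card (X \<inter> A) + \<mu> * card (X \<inter> I)"
    if "X \<subseteq> V" for X
  proof -
    have X: "X = (X \<inter> {b}) \<union> ((X \<inter> A) \<union> (X \<inter> I))" using that I by auto
    have "sum w X = sum w (X \<inter> {b}) + (sum w (X \<inter> A) + sum w (X \<inter> I))"
      by (subst X, subst sum.union_disjoint, use fA fI AI bI A(3) in \<open>auto simp: Int_Un_distrib\<close>)
        (subst sum.union_disjoint, use fA fI AI bI A(3) in auto)
    moreover have "sum w (X \<inter> A) = t * card (X \<inter> A)"
    proof -
      have "sum w (X \<inter> A) = (\<Sum>v\<in>X \<inter> A. t)" using A(3) by (intro sum.cong) (auto simp: w_def)
      then show ?thesis by simp
    qed
    moreover have "sum w (X \<inter> I) = \<mu> * card (X \<inter> I)"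
    proof -
      have "sum w (X \<inter> I) = (\<Sum>v\<in>X \<inter> I. \<mu>)" using AI bI by (intro sum.cong) (auto simp: w_def)
      then show ?thesis by simp
    qed
    moreover have "sum w (X \<inter> {b}) = (if b \<in> X then \<beta> else 0)" by (auto simp: w_def)
    ultimately show ?thesis by simp
  qed
  have wS: "sum w (insert b A) = 1 + \<beta>"
  proof -
    have "insert b A \<inter> A = A" "insert b A \<inter> I = {}" using bI AI by auto
    then show ?thesis using wsum[of "insert b A"] A(2) b tA by simp
  qed
  \<comment> \<open>By independence the components outside are single vertices of weight
    \<open>\<mu>\<close>; a component inside contains \<open>b\<close> or equals
    \<open>A\<close>.\<close>
  have "safe w (insert b A)"
    unfolding safe_def
  proof (intro conjI allI impI)
    fix K L assume K: "is_comp K (insert b A)" and L: "is_comp L (V - insert b A)"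
    have LI: "L \<subseteq> I" "conn L" using L I by (auto simp: is_comp_def)
    obtain l where l: "l \<in> L" using conn_ne[OF LI(2)] by auto
    have "closed_in {l} L" using indep LI(1) l by (auto simp: closed_in_def)
    then have "L = {l}" using conn_closed_eq[OF LI(2), of "{l}"] l by auto
    then have "sum w L = \<mu>" using LI(1) bI AI by (auto simp: w_def)
    moreover have "\<mu> \<le> sum w K"
    proof (cases "b \<in> K")
      case True
      have "K \<subseteq> V" using K A(2) b by (auto simp: is_comp_def)
      then have "sum w K = \<beta> + t * card (K \<inter> A) + \<mu> * card (K \<inter> I)" using wsum True by simp
      moreover have "0 \<le> t * card (K \<inter> A)" "0 \<le> \<mu> * card (K \<inter> I)" using t0 m by auto
      ultimately have "\<beta> \<le> sum w K" by linarith
      then show ?thesis using m by simp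
    next
      case False
      then have "K \<subseteq> A" "K \<noteq> {}" "closed_in K A"
        using K conn_ne by (auto simp: is_comp_def closed_in_def)
      then have "K = A" by (intro conn_closed_eq[OF A(1)])
      then have "sum w K = 1" using wsum[of A] A(2,3) AI tA by simp
      then show ?thesis using m by simp
    qed
    ultimately show "sum w L \<le> sum w K" by simp
  qed (use b A in auto)
  then obtain T where T: "T \<subseteq> V" "conn T" "sum w T \<le> 1 + \<beta>"
    and heavy: "\<And>L. L \<subseteq> V - T \<Longrightarrow> conn L \<Longrightarrow> sum w L \<le> sum w T"
    using light_connected_set[of w "insert b A"] pos wS by metis
  have wT: "sum w T = (if b \<in> T then \<beta> else 0) + t * card (T \<inter> A) + \<mu> * card (T \<inter> I)"
    by (rule wsum[OF T(1)])
  have TA: "t \<le> t * card (T \<inter> A)" if "T \<inter> A \<noteq> {}"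
  proof -
    have "1 \<le> card (T \<inter> A)" using that fA by (simp add: Suc_le_eq card_gt_0_iff)
    then have "1 \<le> real (card (T \<inter> A))" by linarith
    then show ?thesis using mult_left_mono[of 1 "real (card (T \<inter> A))" t] t0 by simp
  qed
  have TA1: "t * card (T \<inter> A) \<le> 1"
    using mult_left_mono[of "real (card (T \<inter> A))" "real (card A)" t] card_mono[OF fA, of "T \<inter> A"] t0 tA by simp
  have mu0: "0 < \<mu>" using m by simp
  have card_diff: "real (card X) - card (T \<inter> I) \<le> card (X - T)" if "X \<subseteq> I" for X
  proof -
    have "card X = card (X - T) + card (X \<inter> T)"
      using card_Int_Diff[of X T] that fI finite_subset by (metis add.commute)
    moreover have "card (X \<inter> T) \<le> card (T \<inter> I)"
      using that fI by (intro card_mono) auto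
    ultimately show ?thesis by linarith
  qed
  have mucard: "\<mu> * k \<le> \<mu> * card (T \<inter> I)" if "k \<le> card (T \<inter> I)" for k :: nat
    using that mu0 by simp
  show False
  proof (cases "2 \<le> card (T \<inter> I)")
    case True
    \<comment> \<open>As \<open>I\<close> is independent, \<open>T\<close> also contains
      \<open>b\<close> or a vertex of \<open>A\<close>. Its weight is at least
      \<open>\<beta> + 2 * \<mu>\<close> or \<open>t + 2 * \<mu>\<close>, above
      \<open>1 + \<beta>\<close> either way.\<close>
    have "\<mu> * 2 \<le> \<mu> * card (T \<inter> I)" using mucard[of 2] True by simp
    moreover have "T \<inter> A \<noteq> {}" if "b \<notin> T"
    proof
      assume "T \<inter> A = {}"
      then have TI: "T \<subseteq> I" using that T(1) I by auto
      obtain l where l: "l \<in> T" using conn_ne[OF T(2)] by auto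
      have "closed_in {l} T" using indep TI l by (auto simp: closed_in_def)
      then have "T = {l}" using conn_closed_eq[OF T(2), of "{l}"] l by auto
      then show False using True TI by (cases "l \<in> I") auto
    qed
    moreover have "0 \<le> t * card (T \<inter> A)" using t0 by simp
    moreover from calculation have "t \<le> t * card (T \<inter> A)" if "b \<notin> T" using TA that by blast
    moreover have "sum w T = \<beta> + t * card (T \<inter> A) + \<mu> * card (T \<inter> I)" if "b \<in> T"
      using wT that by simp
    moreover have "sum w T = t * card (T \<inter> A) + \<mu> * card (T \<inter> I)" if "b \<notin> T"
      using wT that by simp
    ultimately show False using T(3) m by (cases "b \<in> T"; linarith)
  next
    case False
    then have c1: "real (card (T \<inter> I)) \<le> 1" by simp
    have muc: "\<mu> * card (T \<inter> I) \<le> \<mu>" using mult_left_mono[OF c1, of \<mu>] mu0 by simp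
    show False
    proof (cases "b \<in> T")
      case True
      show False
      proof (cases "T \<inter> A = {}")
        case TA0: True
        \<comment> \<open>\<open>T\<close> weighs at most \<open>\<beta> + \<mu>\<close> and misses
          \<open>A\<close>, but \<open>A\<close> with its remaining neighbours in \<open>I\<close>
          is heavier by \<open>mA\<close>.\<close>
        have "IA \<subseteq> V" using IA I by auto
        have L: "conn (A \<union> (IA - T))"
          by (rule conn_attach) (use IA fI A(1) in auto)
        have "sum w (A \<union> (IA - T)) \<le> sum w T"
          using L TA0 IA I A(2) by (intro heavy) auto
        moreover have "sum w (A \<union> (IA - T)) = 1 + \<mu> * card (IA - T)"
        proof -
          have "(A \<union> (IA - T)) \<inter> A = A" "(A \<union> (IA - T)) \<inter> I = IA - T" "b \<notin> A \<union> (IA - T)"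
            using IA I A(3) by auto
          moreover have "A \<union> (IA - T) \<subseteq> V" using A(2) \<open>IA \<subseteq> V\<close> by auto
          ultimately show ?thesis using wsum[of "A \<union> (IA - T)"] tA by (simp only: if_False)
        qed
        moreover have "\<mu> * (real (card IA) - 1) \<le> \<mu> * card (IA - T)"
          using card_diff[of IA] IA c1 mu0 by (intro mult_left_mono) auto
        ultimately show False using wT True TA0 muc mA by simp
      next
        case TA1: False
        \<comment> \<open>Having no neighbour in \<open>A\<close>, \<open>b\<close> is linked to it
          only through \<open>I\<close>, so \<open>T\<close> weighs at least
          \<open>\<beta> + t + \<mu>\<close>.\<close>
        have "T \<inter> I \<noteq> {}"
        proof
          assume "T \<inter> I = {}"
          then have "closed_in {b} T" using bA T(1) I E_irrefl by (auto simp: closed_in_def)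
          then have "T = {b}" using conn_closed_eq[OF T(2), of "{b}"] True by auto
          then show False using TA1 A(3) by auto
        qed
        then have "1 \<le> card (T \<inter> I)" using fI by (simp add: Suc_le_eq card_gt_0_iff)
        then have "\<mu> \<le> \<mu> * card (T \<inter> I)" using mucard[of 1] by simp
        moreover have "sum w T = \<beta> + t * card (T \<inter> A) + \<mu> * card (T \<inter> I)" using wT True by simp
        ultimately show False using TA[OF TA1] T(3) m by linarith
      qed
    next
      case bT: False
      \<comment> \<open>Here \<open>T\<close> weighs at most \<open>1 + \<mu>\<close>, and the star
        from \<open>b\<close> to \<open>Ib - T\<close> is heavier by \<open>mb\<close>.\<close>
      have "insert b (Ib - T) \<subseteq> V" using Ib I b by auto
      have L: "conn (insert b (Ib - T))" using Ib by (intro conn_star) (auto simp: nbh_def)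
      have "sum w (insert b (Ib - T)) \<le> sum w T"
        using L bT Ib I b by (intro heavy) auto
      moreover have "sum w (insert b (Ib - T)) = \<beta> + \<mu> * card (Ib - T)"
      proof -
        have "insert b (Ib - T) \<inter> A = {}" "insert b (Ib - T) \<inter> I = Ib - T"
          using Ib I A(3) by auto
        then show ?thesis using wsum[OF \<open>insert b (Ib - T) \<subseteq> V\<close>] by simp
      qed
      moreover have "\<mu> * (real (card Ib) - 1) \<le> \<mu> * card (Ib - T)"
        using card_diff[of Ib] Ib c1 mu0 by (intro mult_left_mono) auto
      ultimately show False using wT bT muc mb TA1 by simp
    qed
  qed
qed

text \<open>Configuration (Q). As \<open>z\<close> is not isolated, \<open>A\<close> or
  \<open>b\<close> has at least three neighbours in the independent set. That end gets slightly less
  weight than the other, which needs a small surplus to win with only two neighbours.\<close>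

lemma no_star_complement:
  assumes A: "conn A" "A \<subseteq> V" "b \<notin> A" and b: "b \<in> V"
    and bA: "\<And>v. v \<in> A \<Longrightarrow> (b, v) \<notin> E"
    and indep: "\<And>u v. u \<in> V - A - {b} \<Longrightarrow> v \<in> V - A - {b} \<Longrightarrow> (u, v) \<notin> E"
    and xy: "x \<noteq> y" "(b, x) \<in> E" "(b, y) \<in> E" "p \<in> A" "(p, x) \<in> E" "q \<in> A" "(q, y) \<in> E"
    and z: "z \<in> V - A - {b}" "z \<noteq> x" "z \<noteq> y"
  shows False
proof -
  define I where "I = V - A - {b}"
  define IA where "IA = {i \<in> I. \<exists>a \<in> A. (a, i) \<in> E}"
  define Ib where "Ib = {i \<in> I. (b, i) \<in> E}"
  define t where "t = 1 / real (card A)"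
  have fin: "finite IA" "finite Ib" using finite_V by (auto simp: IA_def Ib_def I_def)
  have "1 \<le> card A"
    using conn_ne[OF A(1)] finite_subset[OF A(2) finite_V] by (simp add: Suc_le_eq card_gt_0_iff)
  then have t: "0 < t" "t \<le> 1" by (auto simp: t_def)
  have xyI: "x \<in> I" "y \<in> I"
    using xy bA E_in_V E_irrefl by (auto simp: I_def)
  have sub: "{x, y} \<subseteq> IA" "{x, y} \<subseteq> Ib" using xyI xy by (auto simp: IA_def Ib_def)
  have c2: "2 \<le> card IA" "2 \<le> card Ib"
    using card_mono[OF fin(1) sub(1)] card_mono[OF fin(2) sub(2)] xy(1) by auto
  have "z \<in> IA \<or> z \<in> Ib"
  proof (rule ccontr)
    assume no: "\<not> (z \<in> IA \<or> z \<in> Ib)"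
    have "(z, v) \<notin> E" if "v \<in> V" for v
      using no z(1) indep[of z v] that E_sym[of z v] by (auto simp: IA_def Ib_def I_def)
    then have "closed_in {z} V" by (auto simp: closed_in_def)
    then have "V = {z}" using conn_closed_eq[OF conn_V, of "{z}"] z by auto
    then show False using b z by auto
  qed
  then show False
  proof
    assume "z \<in> IA"
    then have "card {x, y, z} \<le> card IA" using fin sub by (intro card_mono) auto
    then have c3: "3 \<le> card IA" using xy(1) z by auto
    have "real (card IA) \<ge> 3" "real (card Ib) \<ge> 2" using c3 c2 by linarith+
    then show False
      using t by (intro no_light_star_weights[OF A b I_def bA _ IA_def Ib_def t_def, of 1 "1 + t / 2"])
        (auto simp: indep I_def)
  next
    assume "z \<in> Ib"
    then have "card {x, y, z} \<le> card Ib" using fin sub by (intro card_mono) auto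
    then have c3: "3 \<le> card Ib" using xy(1) z by auto
    have c: "real (card IA) - 1 \<ge> 1" "real (card Ib) - 1 \<ge> 2" using c3 c2 by linarith+
    \<comment> \<open>Now \<open>\<beta> = 1 - t / 8\<close> lies below the weight 1 of
      \<open>A\<close>, and \<open>\<mu>\<close> must drop with it to keep
      \<open>\<mu> \<le> \<beta>\<close>.\<close>
    define \<mu> where "\<mu> = 1 - t / 4"
    have "\<mu> * 1 \<le> \<mu> * (real (card IA) - 1)" by (rule mult_left_mono) (use t c in \<open>auto simp: \<mu>_def\<close>)
    then have mA: "(1 - t / 8) + \<mu> < 1 + \<mu> * (real (card IA) - 1)" using t by linarith
    have "\<mu> * 2 \<le> \<mu> * (real (card Ib) - 1)" by (rule mult_left_mono) (use t c in \<open>auto simp: \<mu>_def\<close>)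
    then have mb: "1 + \<mu> < (1 - t / 8) + \<mu> * (real (card Ib) - 1)" using t \<mu>_def by linarith
    show False
      by (rule no_light_star_weights[OF A b I_def bA _ IA_def Ib_def t_def _ _ _ _ _ mA mb])
        (use t indep in \<open>auto simp: I_def \<mu>_def\<close>)
  qed
qed

end

section \<open>Vertices at distance four\<close>

locale triangle_free_cs_graph = cs_fin_graph +
  assumes no_triangle: "\<lbrakk>(x, y) \<in> E; (y, z) \<in> E\<rbrakk> \<Longrightarrow> (z, x) \<notin> E"
begin

definition good :: "'a \<Rightarrow> bool" where
  "good a \<longleftrightarrow> (\<forall>K. conn K \<longrightarrow> K \<subseteq> ball a \<longrightarrow> conn (V - K))"

definition near_noncut :: "'a \<Rightarrow> bool" where
  "near_noncut a \<longleftrightarrow>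
     (\<forall>z \<in> V - ball a. conn (V - ball a - {z}) \<longrightarrow> (\<exists>n \<in> nbh a. (n, z) \<in> E))"

lemma nbh_independent: "u \<in> nbh a \<Longrightarrow> v \<in> nbh a \<Longrightarrow> (u, v) \<notin> E"
  using no_triangle[of a u v] E_sym by (auto simp: nbh_def)

lemma ball_subset: "a \<in> V \<Longrightarrow> ball a \<subseteq> V"
  using nbh_subset by (auto simp: ball_def)

lemma nbh_irrefl: "a \<notin> nbh a"
  using E_irrefl by (auto simp: nbh_def)

text \<open>Configuration (Q) with \<open>A = V - ball b\<close>: what is left besides
  \<open>b\<close> is \<open>nbh b\<close>, independent because there are no triangles.\<close>

lemma no_claw_centre:
  assumes "b \<in> V" "conn (V - ball b)"
    and "x \<in> nbh b" "y \<in> nbh b" "z \<in> nbh b" "x \<noteq> y" "z \<noteq> x" "z \<noteq> y"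
    and "p \<in> V - ball b" "(p, x) \<in> E" "q \<in> V - ball b" "(q, y) \<in> E"
  shows False
proof -
  have eq: "V - (V - ball b) - {b} = nbh b"
    using ball_subset[OF assms(1)] nbh_irrefl by (auto simp: ball_def)
  show False
  proof (rule no_star_complement[of "V - ball b" b x y p q z])
    show "(u, v) \<notin> E" if "u \<in> V - (V - ball b) - {b}" "v \<in> V - (V - ball b) - {b}" for u v
      using that nbh_independent unfolding eq by blast
    show "z \<in> V - (V - ball b) - {b}" unfolding eq by fact
  qed (use assms in \<open>auto simp: ball_def nbh_def\<close>)
qed

text \<open>Goodness is tested on \<open>ball a\<close>, on \<open>ball a\<close> without
  \<open>n\<close>, and on a single neighbour of \<open>a\<close>. A third neighbour of
  \<open>a\<close>, or a non-cut vertex of \<open>V - ball a\<close> with no neighbour in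
  \<open>nbh a\<close>, would give configuration (Q).\<close>

lemma good_imp:
  assumes "good a" "a \<in> V" "V \<noteq> ball a"
  shows "conn (V - ball a)" and "\<And>n. n \<in> nbh a \<Longrightarrow> \<exists>p \<in> V - ball a. (p, n) \<in> E"
    and "near_noncut a" and "\<exists>x y. x \<noteq> y \<and> nbh a = {x, y}"
proof -
  show R: "conn (V - ball a)" using assms(1) conn_ball by (auto simp: good_def)
  show touch: "\<exists>p \<in> V - ball a. (p, n) \<in> E" if n: "n \<in> nbh a" for n
  proof -
    have "conn (insert a (nbh a - {n}))" by (intro conn_star) auto
    then have c: "conn (V - insert a (nbh a - {n}))"
      using assms(1) by (auto simp: good_def ball_def)
    have eq: "V - insert a (nbh a - {n}) = insert n (V - ball a)"
      using n nbh_irrefl nbh_subset by (auto simp: ball_def)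
    have "n \<notin> V - ball a" using n by (auto simp: ball_def)
    then have "V - ball a \<noteq> insert n (V - ball a)" by auto
    then have "\<not> closed_in (V - ball a) (insert n (V - ball a))"
      using conn_closed_eq[OF c[unfolded eq], of "V - ball a"] conn_ne[OF R] by auto
    then show ?thesis by (auto simp: closed_in_def)
  qed
  obtain x where x: "x \<in> nbh a"
  proof -
    have "{a} \<noteq> V" using assms(3) ball_subset[OF assms(2)] by (auto simp: ball_def)
    then have "\<not> closed_in {a} V"
      using conn_closed_eq[OF conn_V, of "{a}"] assms(2) by auto
    then show thesis using that by (auto simp: closed_in_def nbh_def)
  qed
  obtain y where y: "y \<in> nbh a" "y \<noteq> x"
  proof -
    \<comment> \<open>The graph stays connected without \<open>x\<close>, so \<open>a\<close> keeps
      a neighbour.\<close>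
    have "conn (V - {x})" using assms(1) conn_singleton x by (auto simp: good_def ball_def)
    moreover have "a \<noteq> x" using x nbh_irrefl by auto
    moreover have "{a} \<noteq> V - {x}" using conn_ne[OF R] x by (auto simp: ball_def)
    ultimately have "\<not> closed_in {a} (V - {x})"
      using conn_closed_eq[of "V - {x}" "{a}"] assms(2) by auto
    then show thesis using that by (auto simp: closed_in_def nbh_def)
  qed
  obtain p where p: "p \<in> V - ball a" "(p, x) \<in> E" using touch[OF x] by auto
  obtain q where q: "q \<in> V - ball a" "(q, y) \<in> E" using touch[OF y(1)] by auto
  have "nbh a \<subseteq> {x, y}"
    using no_claw_centre[OF assms(2) R x y(1) _ y(2)[symmetric] _ _ p q] by auto
  then have xy: "nbh a = {x, y}" using x y by auto
  then show "\<exists>x y. x \<noteq> y \<and> nbh a = {x, y}" using y(2) by metis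
  show "near_noncut a"
    unfolding near_noncut_def
  proof (intro ballI impI, rule ccontr)
    fix z assume z: "z \<in> V - ball a" "conn (V - ball a - {z})" "\<not> (\<exists>n \<in> nbh a. (n, z) \<in> E)"
    \<comment> \<open>Moving \<open>z\<close> away from the connected side turns the independent set
      into \<open>{x, y, z}\<close>.\<close>
    let ?A = "V - ball a - {z}"
    have eq: "V - ?A - {a} = {x, y, z}"
      using z(1) xy x y nbh_irrefl nbh_subset by (auto simp: ball_def)
    have no: "(x, y) \<notin> E" "(y, x) \<notin> E" "(x, z) \<notin> E" "(y, z) \<notin> E" "(z, x) \<notin> E" "(z, y) \<notin> E"
      using z(3) xy nbh_independent[OF x y(1)] E_sym by auto
    have pq: "p \<in> ?A" "q \<in> ?A" using p q no by auto
    show False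
    proof (rule no_star_complement[of ?A a x y p q z])
      show "(u, v) \<notin> E" if "u \<in> V - ?A - {a}" "v \<in> V - ?A - {a}" for u v
        using that no E_irrefl unfolding eq by auto
      show "z \<in> V - ?A - {a}" unfolding eq by simp
      show "(a, v) \<notin> E" if "v \<in> ?A" for v using that by (auto simp: ball_def nbh_def)
      show "(a, x) \<in> E" "(a, y) \<in> E" using x y by (auto simp: nbh_def)
      show "z \<noteq> x" "z \<noteq> y" using z(1) x y by (auto simp: ball_def)
    qed (use z(2) y(2) p(2) q(2) pq assms(2) in \<open>auto simp: ball_def\<close>)
  qed
qed

text \<open>Growing the connected set \<open>V - ball a - W\<close> shows that a component
  \<open>W\<close> cut off from \<open>ball a\<close> contains a non-cut vertex of
  \<open>V - ball a\<close>. Its neighbour in \<open>nbh a\<close> would have to lie in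
  \<open>W\<close> too.\<close>

lemma conn_Diff_of_near_noncut:
  assumes "a \<in> V" "conn (V - ball a)" "near_noncut a" "conn K" "K \<subseteq> V - ball a"
  shows "conn (V - K)"
proof (rule ccontr)
  assume "\<not> conn (V - K)"
  moreover have "ball a \<subseteq> V - K" using ball_subset[OF assms(1)] assms(5) by auto
  ultimately obtain W where W: "is_comp W (V - K)" "W \<inter> ball a = {}"
    using not_conn_other_comp conn_ball by blast
  let ?M = "V - ball a"
  have WM: "W \<subseteq> ?M" "W \<noteq> {}" using W conn_ne by (auto simp: is_comp_def)
  have KM: "K \<subseteq> ?M - W" using W(1) assms(5) by (auto simp: is_comp_def)
  have cl: "closed_in W (?M - K)" using W(1) by (auto simp: is_comp_def closed_in_def)
  have "conn (?M - W)"
    by (rule conn_Diff[OF assms(2,4) KM WM(1) cl])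
  then obtain z where z: "z \<in> ?M - (?M - W)" "conn (?M - {z})"
    using exists_noncut_vertex[OF _ assms(2), of "?M - W"] WM finite_V by blast
  then obtain n where n: "n \<in> nbh a" "(n, z) \<in> E"
    using assms(3) by (auto simp: near_noncut_def)
  have "n \<in> V - K" using n(1) \<open>ball a \<subseteq> V - K\<close> by (auto simp: ball_def)
  then have "n \<in> W"
    using W(1) z(1) E_sym[OF n(2)] by (auto simp: is_comp_def closed_in_def)
  then show False using W(2) n(1) by (auto simp: ball_def)
qed

text \<open>Since \<open>ball e\<close> lies in \<open>V - ball a\<close>, \<open>e\<close> is good
  as well. Then \<open>ball n\<close>, which lies in \<open>V - ball e\<close>, does not separate,
  and configuration (Q) centred at \<open>n\<close> bounds the degree of \<open>n\<close>.\<close>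

lemma cycle_neighbourhood:
  assumes "good a" "a \<in> V" "e \<in> V"
    and far: "\<And>u v. u \<in> ball a \<Longrightarrow> v \<in> ball e \<Longrightarrow> u \<noteq> v \<and> (u, v) \<notin> E"
    and n: "n \<in> nbh a"
  shows "\<exists>n1 \<in> V - ball a. nbh n = {a, n1}"
proof -
  let ?R = "V - ball a"
  have selfs: "a \<in> ball a" "e \<in> ball e" by (auto simp: ball_def)
  have disj: "ball a \<inter> ball e = {}" using far by blast
  then have ne: "V \<noteq> ball a" "V \<noteq> ball e" using assms(2,3) selfs by auto
  note ga = good_imp[OF assms(1,2) ne(1)]
  have "good e"
    unfolding good_def
  proof (intro allI impI)
    fix K assume K: "conn K" "K \<subseteq> ball e"
    then have "K \<subseteq> V - ball a" using disj ball_subset[OF assms(3)] by auto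
    then show "conn (V - K)"
      using conn_Diff_of_near_noncut[OF assms(2) ga(1,3) K(1)] by simp
  qed
  note ge = good_imp[OF this assms(3) ne(2)]
  have nV: "n \<in> V" using n nbh_subset by auto
  have an: "(a, n) \<in> E" "(n, a) \<in> E" using n E_sym by (auto simp: nbh_def)
  have ball_n: "ball n \<subseteq> V - ball e"
  proof
    fix v assume "v \<in> ball n"
    moreover have "n \<in> ball a" using n by (auto simp: ball_def)
    ultimately show "v \<in> V - ball e"
      using far[of n v] far[of n n] ball_subset[OF nV] by (auto simp: ball_def nbh_def)
  qed
  have Rn: "conn (V - ball n)"
    by (rule conn_Diff_of_near_noncut[OF assms(3) ge(1,3) conn_ball ball_n])
  obtain p where p: "p \<in> ?R" "(p, n) \<in> E" using ga(2)[OF n] by auto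
  have "nbh n \<subseteq> {a, p}"
  proof (rule ccontr)
    assume "\<not> nbh n \<subseteq> {a, p}"
    then obtain q where q: "q \<in> nbh n" "q \<noteq> a" "q \<noteq> p" by auto
    obtain m where m: "m \<in> nbh a" "m \<noteq> n" using ga(4) n by auto
    have mn: "m \<in> V - ball n"
      using m n nbh_independent[OF n m(1)] nbh_subset by (auto simp: ball_def nbh_def)
    have ma: "(m, a) \<in> E" using m(1) E_sym by (auto simp: nbh_def)
    \<comment> \<open>(Q) needs two neighbours of \<open>n\<close> with neighbours outside
      \<open>ball n\<close>. One is \<open>a\<close>, through \<open>m\<close>. The other is
      \<open>u\<close>, through \<open>v\<close>: as \<open>?R\<close> is connected and
      \<open>e\<close> lies outside \<open>?U\<close>, some edge \<open>uv\<close> leaves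
      \<open>?U\<close>.\<close>
    let ?U = "?R \<inter> nbh n"
    have pU: "p \<in> ?U" using p E_sym by (auto simp: nbh_def)
    have "e \<in> ?R - ?U" using ball_n disj selfs assms(3) by (auto simp: ball_def)
    then have "\<not> closed_in ?U ?R"
      using conn_closed_eq[OF ga(1), of ?U] pU by blast
    then obtain u v where uv: "u \<in> ?U" "v \<in> ?R" "v \<notin> ?U" "(u, v) \<in> E"
      by (auto simp: closed_in_def)
    have vn: "v \<in> V - ball n" using uv n by (auto simp: ball_def)
    have "a \<noteq> u" using uv(1) selfs by auto
    have an': "a \<in> nbh n" using an by (simp add: nbh_def)
    have vu: "(v, u) \<in> E" using uv(4) by (rule E_sym)
    have un: "u \<in> nbh n" using uv(1) by auto
    have pn: "p \<in> nbh n" "p \<noteq> a" using pU selfs by auto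
    \<comment> \<open>\<open>u\<close> can coincide with at most one of \<open>p\<close> and
      \<open>q\<close>; the other serves as the third neighbour.\<close>
    show False
      using no_claw_centre[OF nV Rn an' un q(1) \<open>a \<noteq> u\<close> q(2) _ mn ma vn vu]
        no_claw_centre[OF nV Rn an' un pn(1) \<open>a \<noteq> u\<close> pn(2) _ mn ma vn vu] q(3) by blast
  qed
  then have "nbh n = {a, p}" using an E_sym[OF p(2)] by (auto simp: nbh_def)
  then show ?thesis using p(1) by auto
qed

text \<open>A shortest path from \<open>x1\<close> to \<open>y1\<close> in \<open>V - ball a\<close>
  is induced. If it missed a vertex, some non-cut vertex off the path would be adjacent to
  \<open>x\<close> or \<open>y\<close>, hence be \<open>x1\<close> or \<open>y1\<close>, which are
  on it. The path closes up through \<open>y\<close>, \<open>a\<close>, \<open>x\<close>.\<close>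

lemma noncut_path_cycle:
  assumes a: "a \<in> V" "nbh a = {x, y}" "x \<noteq> y"
    and R: "conn (V - ball a)" "near_noncut a"
    and x1: "x1 \<in> V - ball a" "nbh x = {a, x1}" and y1: "y1 \<in> V - ball a" "nbh y = {a, y1}"
  shows "\<exists>vs. distinct vs \<and> 3 \<le> length vs \<and> V = set vs \<and>
    E = (\<Union>i < length vs. {(vs ! i, vs ! (Suc i mod length vs)), (vs ! (Suc i mod length vs), vs ! i)})"
proof -
  let ?R = "V - ball a"
  let ?r = "E \<inter> ?R \<times> ?R"
  define n where "n = (LEAST n. (x1, y1) \<in> ?r ^^ n)"
  have "\<exists>n. (x1, y1) \<in> ?r ^^ n"
    using conn_imp_rtrancl[OF R(1) x1(1) y1(1)] by (simp add: rtrancl_power)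
  then have n: "(x1, y1) \<in> ?r ^^ n" and least: "\<And>k. (x1, y1) \<in> ?r ^^ k \<Longrightarrow> n \<le> k"
    unfolding n_def by (auto intro: LeastI Least_le)
  obtain f where f: "f 0 = x1" "f n = y1" "\<And>i. i < n \<Longrightarrow> (f i, f (Suc i)) \<in> ?r"
    using n by (auto simp: relpow_fun_conv)
  have seg: "(f i, f (i + k)) \<in> ?r ^^ k" if "i + k \<le> n" for i k
    using that
  proof (induction k)
    case (Suc k) then show ?case using f(3)[of "i + k"] by auto
  qed simp
  have pre: "(x1, f i) \<in> ?r ^^ i" if "i \<le> n" for i using seg[of 0 i] that f(1) by simp
  have post: "(f j, y1) \<in> ?r ^^ (n - j)" if "j \<le> n" for j using seg[of j "n - j"] that f(2) by simp
  have compose: "(p, q) \<in> ?r ^^ (i + j)" if "(p, o') \<in> ?r ^^ i" "(o', q) \<in> ?r ^^ j" for p o' q i j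
    using that unfolding relpow_add by (rule relcompI)
  \<comment> \<open>A repeated vertex, and likewise a chord in the next claim, would give a walk
    shorter than \<open>n\<close>.\<close>
  have inj: "f i \<noteq> f j" if "i < j" "j \<le> n" for i j
  proof
    assume "f i = f j"
    then have "(x1, y1) \<in> ?r ^^ (i + (n - j))"
      using compose[OF pre[of i] post[of j, folded \<open>f i = f j\<close>]] that by simp
    then show False using least[of "i + (n - j)"] that by simp
  qed
  have chord: "j = Suc i" if "i < j" "j \<le> n" "(f i, f j) \<in> E" for i j
  proof (rule ccontr)
    assume "j \<noteq> Suc i"
    have "f i \<in> ?R" using f(3)[of i] that by auto
    moreover have "f j \<in> ?R" using f(3)[of "j - 1"] that by auto
    ultimately have "(x1, f j) \<in> ?r ^^ Suc i"
      using pre[of i] that by auto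
    then have "(x1, y1) \<in> ?r ^^ (Suc i + (n - j))"
      using compose[OF _ post[of j]] that by blast
    then show False using least[of "Suc i + (n - j)"] that \<open>j \<noteq> Suc i\<close> by simp
  qed
  have fR: "f i \<in> ?R" if "i \<le> n" for i
  proof (cases i)
    case 0 then show ?thesis using f(1) x1 by simp
  next
    case (Suc k) then show ?thesis using f(3)[of k] that by auto
  qed
  have conn_f: "conn (f ` {..k})" if "k \<le> n" for k
    using that
  proof (induction k)
    case 0 then show ?case by (simp add: conn_singleton)
  next
    case (Suc k)
    then show ?case
      using conn_insert[of "f ` {..k}" "f k" "f (Suc k)"] f(3)[of k] by (auto simp: atMost_Suc)
  qed
  have ends: "x1 \<in> f ` {..n}" "y1 \<in> f ` {..n}" using f(1,2) by auto
  have sub: "f ` {..n} \<subseteq> ?R" using fR by auto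
  have img: "f ` {..n} = ?R"
  proof (rule ccontr)
    assume "f ` {..n} \<noteq> ?R"
    with sub have "f ` {..n} \<subset> ?R" by (rule psubsetI)
    then obtain z where z: "z \<in> ?R - f ` {..n}" "conn (?R - {z})"
      using exists_noncut_vertex[OF _ R(1) conn_f[of n]] finite_V by auto
    then obtain m where "m \<in> nbh a" "(m, z) \<in> E" using R(2) by (auto simp: near_noncut_def)
    then have "z \<in> nbh x \<or> z \<in> nbh y" using a(2) by (auto simp: nbh_def)
    then have "z = a \<or> z = x1 \<or> z = y1" using x1(2) y1(2) by auto
    then show False using z(1) ends by (auto simp: ball_def)
  qed
  \<comment> \<open>The cycle in order: \<open>a\<close>, \<open>x\<close>, then \<open>f i\<close>
    at position \<open>i + 2\<close>, and \<open>y\<close> at \<open>n + 3\<close>. If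
    \<open>x1 = y1\<close>, then \<open>n = 0\<close> and this is a four-cycle.\<close>
  define g where "g i = (if i = 0 then a else if i = 1 then x else if i = n + 3 then y else f (i - 2))" for i
  define vs where "vs = map g [0..<n + 4]"
  have len: "length vs = n + 4" by (simp add: vs_def)
  have nth: "vs ! i = g i" if "i < n + 4" for i using that by (simp add: vs_def)
  have V: "V = {a, x, y} \<union> f ` {..n}"
    using img a ball_subset[OF a(1)] by (auto simp: ball_def)
  have outside: "a \<notin> ?R" "x \<notin> ?R" "y \<notin> ?R" using a(2) by (auto simp: ball_def)
  have ax: "a \<noteq> x" "a \<noteq> y" using a(2) nbh_irrefl[of a] by auto
  have fne: "f i \<noteq> a" "f i \<noteq> x" "f i \<noteq> y" if "i \<le> n" for i
    using fR[OF that] outside by auto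
  have g_simps: "g 0 = a" "g (Suc 0) = x" "g (n + 3) = y" "\<And>k. k \<le> n \<Longrightarrow> g (Suc (Suc k)) = f k"
    by (auto simp: g_def)
  have range: "i = 0 \<or> i = 1 \<or> i = n + 3 \<or> (\<exists>k \<le> n. i = k + 2)" if "i < n + 4" for i
    using that by presburger
  have "inj_on g {..<n + 4}"
  proof (rule linorder_inj_onI)
    fix i j assume ij: "i < j" "i \<in> {..<n + 4}" "j \<in> {..<n + 4}"
    then show "g i \<noteq> g j"
      using range[of i] range[of j] by (auto simp: ax a(3) fne fne[THEN not_sym] inj g_simps)
  qed auto
  then have dist: "distinct vs" by (simp add: vs_def distinct_map atLeast0LessThan)
  have setvs: "V = set vs"
  proof -
    have "set vs = g ` {..<n + 4}" by (auto simp: vs_def)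
    also have "\<dots> = V"
    proof
      show "g ` {..<n + 4} \<subseteq> V"
        using range V g_simps by fastforce
      have "f k \<in> g ` {..<n + 4}" if "k \<le> n" for k
        using g_simps(4)[OF that] that by (intro image_eqI[of _ _ "k + 2"]) auto
      moreover have "a \<in> g ` {..<n + 4}" by (intro image_eqI[of _ _ 0]) (auto simp: g_simps)
      moreover have "x \<in> g ` {..<n + 4}" by (intro image_eqI[of _ _ "Suc 0"]) (auto simp: g_simps)
      moreover have "y \<in> g ` {..<n + 4}" by (intro image_eqI[of _ _ "n + 3"]) (auto simp: g_simps)
      ultimately show "V \<subseteq> g ` {..<n + 4}" using V by auto
    qed
    finally show ?thesis ..
  qed
  \<comment> \<open>The cycle edges in one direction only; \<open>E\<close> turns out to be
    \<open>succ\<close> and its converse.\<close>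
  define succ where "succ = (\<Union>i < n + 4. {(g i, g (Suc i mod (n + 4)))})"
  have succI: "(g i, g (Suc i)) \<in> succ" if "i < n + 3" for i
    using that by (force simp: succ_def)
  have succ_ax: "(a, x) \<in> succ" using succI[of 0] by (simp add: g_simps)
  have succ_x: "(x, x1) \<in> succ" using succI[of 1] g_simps(4)[of 0] f(1) by (simp add: g_simps numeral_2_eq_2)
  have succ_f: "(f k, f (Suc k)) \<in> succ" if "k < n" for k
    using succI[of "k + 2"] g_simps(4)[of k] g_simps(4)[of "Suc k"] that by simp
  have succ_y: "(y1, y) \<in> succ"
    using succI[of "n + 2"] g_simps(4)[of n] g_simps(3) f(2) by (simp add: numeral_3_eq_3)
  have "Suc (n + 3) = n + 4" by simp
  then have wrap: "Suc (n + 3) mod (n + 4) = 0" by (metis mod_self)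
  have "(g (n + 3), g (Suc (n + 3) mod (n + 4))) \<in> succ"
    unfolding succ_def by (rule UN_I[of "n + 3", OF _ insertI1]) simp
  then have succ_ya: "(y, a) \<in> succ" unfolding wrap g_simps .
  have nbrs: "(a, x) \<in> E" "(a, y) \<in> E" "(x, x1) \<in> E" "(y, y1) \<in> E"
    using a(2) x1(2) y1(2) by (auto simp: nbh_def)
  have "succ \<subseteq> E"
  proof
    fix e assume "e \<in> succ"
    then obtain i where i: "i < n + 4" "e = (g i, g (Suc i mod (n + 4)))" by (auto simp: succ_def)
    \<comment> \<open>Position \<open>n + 2\<close> holds the last path vertex, whose successor is
      \<open>y\<close>.\<close>
    consider "i = 0" | "i = 1" | "i = n + 3" | "i = n + 2" | k where "k < n" "i = k + 2"
      using range[OF i(1)] by (auto simp: le_less)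
    then show "e \<in> E"
    proof cases
      case 1 then show ?thesis using i nbrs by (simp add: g_simps)
    next
      case 2 then show ?thesis using i nbrs g_simps(4)[of 0] f(1) by (simp add: g_simps numeral_2_eq_2)
    next
      case 3 then show ?thesis using i E_sym[OF nbrs(2)] wrap g_simps(1,3) by metis
    next
      case 4 then show ?thesis
        using i E_sym[OF nbrs(4)] g_simps(4)[of n] g_simps(3) f(2) by (simp add: numeral_3_eq_3)
    next
      case 5 then show ?thesis
        using i f(3)[of k] g_simps(4)[of k] g_simps(4)[of "Suc k"] by simp
    qed
  qed
  moreover have "(u, v) \<in> succ \<or> (v, u) \<in> succ" if uv: "(u, v) \<in> E" for u v
  proof -
    have spec: "(c, d) \<in> succ \<or> (d, c) \<in> succ" if "(c, d) \<in> E" "c = a \<or> c = x \<or> c = y" for c d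
    proof -
      have "d \<in> nbh c" using that by (simp add: nbh_def)
      then show ?thesis using that(2) a(2) x1(2) y1(2) succ_ax succ_x succ_y succ_ya by auto
    qed
    show ?thesis
    proof (cases "u \<in> {a, x, y} \<or> v \<in> {a, x, y}")
      case True
      then show ?thesis using spec[of u v] spec[of v u] uv E_sym[OF uv] by blast
    next
      case False
      then obtain i j where ij: "i \<le> n" "j \<le> n" "u = f i" "v = f j"
        using E_in_V[OF uv] V by auto
      have "i \<noteq> j" using uv ij E_irrefl by auto
      then have "j = Suc i \<or> i = Suc j"
        using chord[of i j] chord[of j i] ij uv E_sym[OF uv] by (cases "i < j") auto
      then show ?thesis using succ_f ij by auto
    qed
  qed
  ultimately have E: "E = succ \<union> succ\<inverse>" using E_sym by auto
  have "(\<Union>i < length vs. {(vs ! i, vs ! (Suc i mod length vs)), (vs ! (Suc i mod length vs), vs ! i)})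
    = succ \<union> succ\<inverse>"
    by (auto simp: len nth succ_def)
  then show ?thesis using E dist setvs len by (intro exI[of _ vs]) auto
qed

lemma far_vertices_imp_cycle:
  assumes "a \<in> V" "e \<in> V"
    and far: "\<And>u v. u \<in> ball a \<Longrightarrow> v \<in> ball e \<Longrightarrow> u \<noteq> v \<and> (u, v) \<notin> E"
  shows "\<exists>vs. distinct vs \<and> 3 \<le> length vs \<and> V = set vs \<and>
    E = (\<Union>i < length vs. {(vs ! i, vs ! (Suc i mod length vs)), (vs ! (Suc i mod length vs), vs ! i)})"
proof -
  have from_good: ?thesis if h: "good c" "c \<in> V" "d \<in> V"
    and cd: "\<And>u v. u \<in> ball c \<Longrightarrow> v \<in> ball d \<Longrightarrow> u \<noteq> v \<and> (u, v) \<notin> E" for c d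
  proof -
    have "d \<notin> ball c" using cd[of d d] by (auto simp: ball_def)
    then have "V \<noteq> ball c" using h(3) by auto
    note gc = good_imp[OF h(1,2) this]
    obtain x y where xy: "x \<noteq> y" "nbh c = {x, y}" using gc(4) by auto
    obtain x1 where "x1 \<in> V - ball c" "nbh x = {c, x1}"
      using cycle_neighbourhood[OF h(1-3) cd, of x] xy by auto
    moreover obtain y1 where "y1 \<in> V - ball c" "nbh y = {c, y1}"
      using cycle_neighbourhood[OF h(1-3) cd, of y] xy by auto
    ultimately show ?thesis
      using noncut_path_cycle[OF h(2) xy(2,1) gc(1,3)] by blast
  qed
  \<comment> \<open>Witnesses against both would be disjoint, non-adjacent connected
    separators.\<close>
  have "good a \<or> good e"
  proof (rule ccontr)
    assume "\<not> (good a \<or> good e)"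
    then obtain A B where AB: "conn A" "A \<subseteq> ball a" "\<not> conn (V - A)"
      "conn B" "B \<subseteq> ball e" "\<not> conn (V - B)"
      by (auto simp: good_def)
    show False
      by (rule conn_separators_touch[OF AB(1,4) _ _ _ _ AB(3,6)])
        (use AB(2,5) far ball_subset assms in blast)+
  qed
  then show ?thesis
  proof
    assume e: "good e"
    have "u \<noteq> v \<and> (u, v) \<notin> E" if "u \<in> ball e" "v \<in> ball a" for u v
      using far[OF that(2,1)] E_sym[of u v] by auto
    then show ?thesis by (rule from_good[OF e assms(2,1)])
  next
    assume "good a"
    then show ?thesis using assms(1,2) far by (rule from_good)
  qed
qed

end

section \<open>Transfer to digraphs\<close>

text \<open>\<open>connected\<close> means reachability in the symmetric closure of the arcs. A
  closed set absorbs whatever is reachable from it; conversely, the vertices reachable from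
  \<open>u\<close> form a closed set.\<close>

lemma connected_iff_no_closed_subset:
  assumes "wf_digraph H"
  shows "Digraph_Component.connected H \<longleftrightarrow> verts H \<noteq> {} \<and>
    (\<forall>U \<subseteq> verts H. U \<noteq> {} \<longrightarrow>
      (\<forall>u \<in> U. \<forall>v. (u, v) \<in> arcs_ends H \<or> (v, u) \<in> arcs_ends H \<longrightarrow> v \<in> U) \<longrightarrow> U = verts H)"
    (is "_ \<longleftrightarrow> ?ne \<and> (\<forall>U \<subseteq> _. _ \<longrightarrow> ?closed U \<longrightarrow> _)")
proof -
  let ?r = "(arcs_ends H)\<^sup>s"
  have r: "(u, v) \<in> ?r \<longleftrightarrow> (u, v) \<in> arcs_ends H \<or> (v, u) \<in> arcs_ends H" for u v
    by (auto simp: symcl_def)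
  have wf: "u \<in> verts H \<and> v \<in> verts H" if "(u, v) \<in> ?r" for u v
    using that wf_digraph.adj_in_verts[OF assms] unfolding r by blast
  show ?thesis
    unfolding connected_conv
  proof (intro iffI conjI ballI allI impI; (elim conjE)?)
    fix U assume U: "U \<subseteq> verts H" "U \<noteq> {}" "?closed U"
      and c: "\<forall>u\<in>verts H. \<forall>v\<in>verts H. (u, v) \<in> rtrancl_on (verts H) ?r"
    obtain u where u: "u \<in> U" using U(2) by auto
    have "v \<in> U" if "v \<in> verts H" for v
    proof -
      have "(u, v) \<in> rtrancl_on (verts H) ?r" using c u U(1) that by auto
      then show ?thesis
      proof (induction rule: rtrancl_on_induct)
        case base show ?case by (rule u)
      next
        case (step y z) then show ?case using U(3) r by blast
      qed
    qed
    then show "U = verts H" using U(1) by auto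
  next
    fix u v assume uv: "u \<in> verts H" "v \<in> verts H"
      and c: "\<forall>U \<subseteq> verts H. U \<noteq> {} \<longrightarrow> ?closed U \<longrightarrow> U = verts H"
    define U where "U = {v \<in> verts H. (u, v) \<in> rtrancl_on (verts H) ?r}"
    have "q \<in> U" if "p \<in> U" "(p, q) \<in> ?r" for p q
      using that wf[OF that(2)] by (auto simp: U_def intro: rtrancl_on_into_rtrancl_on)
    then have "?closed U" unfolding r by blast
    moreover have "u \<in> U" using uv(1) by (auto simp: U_def)
    ultimately have "U = verts H" using c unfolding U_def by blast
    then show "(u, v) \<in> rtrancl_on (verts H) ?r" using uv(2) by (auto simp: U_def)
  qed auto
qed

lemma connected_closed_eq:
  assumes "wf_digraph H" "Digraph_Component.connected H" "U \<subseteq> verts H" "U \<noteq> {}"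
    and "\<And>u v. u \<in> U \<Longrightarrow> (u, v) \<in> arcs_ends H \<or> (v, u) \<in> arcs_ends H \<Longrightarrow> v \<in> U"
  shows "U = verts H"
  using assms(2-5) unfolding connected_iff_no_closed_subset[OF assms(1)] by blast

section \<open>Induced subgraphs, components and safe sets of a digraph\<close>

context graph begin

lemma fin_graph_arcs_ends: "fin_graph (verts G) (arcs_ends G)"
proof
  show "(v, v) \<notin> arcs_ends G" for v using adj_not_same by blast
  show "arcs_ends G \<subseteq> verts G \<times> verts G" using adj_in_verts by auto
qed (auto intro: graph_symmetric)

sublocale fin: fin_graph "verts G" "arcs_ends G"
  by (rule fin_graph_arcs_ends)

lemma arcs_ends_induce: "arcs_ends (G \<restriction> S) = arcs_ends G \<inter> S \<times> S"
  by (auto simp: arcs_ends_def arc_to_ends_def)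

lemma connected_induce_iff:
  assumes "S \<subseteq> verts G"
  shows "Digraph_Component.connected (G \<restriction> S) \<longleftrightarrow> fin.conn S"
proof -
  have "(\<forall>u \<in> U. \<forall>v. (u, v) \<in> arcs_ends (G \<restriction> S) \<or> (v, u) \<in> arcs_ends (G \<restriction> S) \<longrightarrow> v \<in> U)
      \<longleftrightarrow> fin.closed_in U S" if "U \<subseteq> S" for U
    using that fin.E_sym unfolding fin.closed_in_def arcs_ends_induce by blast
  then show ?thesis
    unfolding connected_iff_no_closed_subset[OF wellformed_induce_subgraph] fin.conn_def by auto
qed

text \<open>Components are maximal connected subgraphs here. Maximality forces closedness, as a
  further neighbour \<open>v\<close> could be added. Conversely, a connected subgraph above
  \<open>G \<restriction> K\<close> gains no vertex because \<open>K\<close> is closed, and no arc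
  because \<open>G \<restriction> K\<close> is induced.\<close>

lemma verts_components_induce:
  assumes S: "S \<subseteq> verts G"
  shows "verts ` components (G \<restriction> S) = {K. fin.is_comp K S}"
proof (intro equalityI subsetI)
  fix K assume "K \<in> verts ` components (G \<restriction> S)"
  then obtain C where K: "K = verts C" and C: "subgraph C (G \<restriction> S)" "Digraph_Component.connected C"
    and max: "\<And>H. H \<noteq> C \<Longrightarrow> subgraph C H \<Longrightarrow> subgraph H (G \<restriction> S) \<Longrightarrow> \<not> Digraph_Component.connected H"
    by (auto simp: components_def pre_digraph.max_subgraph_def)
  have sub: "K \<subseteq> S" "arcs C \<subseteq> arcs (G \<restriction> S)" and wf: "wf_digraph C"
    and th: "tail C = tail G" "head C = head G"
    using C(1) K by (auto simp: subgraph_def compatible_def)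
  have arcsC: "e \<in> arcs G \<and> tail G e \<in> K \<and> head G e \<in> K" if "e \<in> arcs C" for e
    using that sub wf_digraph.tail_in_verts[OF wf that] wf_digraph.head_in_verts[OF wf that] K th by auto
  have ends: "arcs_ends C \<subseteq> arcs_ends G \<inter> K \<times> K"
    using arcsC th by (auto simp: arcs_ends_def arc_to_ends_def)
  have "fin.conn K"
    unfolding fin.conn_def
  proof (intro conjI allI impI)
    show "K \<noteq> {}" using C(2) unfolding K connected_conv by blast
    fix U assume U: "U \<subseteq> K" "U \<noteq> {}" "fin.closed_in U K"
    have "v \<in> U" if "u \<in> U" "(u, v) \<in> arcs_ends C \<or> (v, u) \<in> arcs_ends C" for u v
    proof -
      have "(u, v) \<in> arcs_ends G" "v \<in> K" using that(2) ends fin.E_sym by auto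
      then show ?thesis using that(1) U(3) by (auto simp: fin.closed_in_def)
    qed
    then show "U = K"
      unfolding K using connected_closed_eq[OF wf C(2)] U(1,2) K by blast
  qed
  moreover have "fin.closed_in K S"
    unfolding fin.closed_in_def
  proof (intro ballI impI, rule ccontr)
    fix u v assume uv: "u \<in> K" "v \<in> S" "(u, v) \<in> arcs_ends G" "v \<notin> K"
    let ?H = "G \<restriction> insert v K"
    have "verts ?H \<noteq> verts C" using uv(4) K by auto
    then have "?H \<noteq> C" by metis
    moreover have "subgraph C ?H"
      using arcsC th K wf by (auto simp: subgraph_def compatible_def)
    moreover have "subgraph ?H (G \<restriction> S)"
      using sub(1) uv(2) by (auto simp: subgraph_def compatible_def)
    moreover have "Digraph_Component.connected ?H"
      using fin.conn_insert[OF \<open>fin.conn K\<close> uv(1,3)] sub(1) uv(2) S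
      by (subst connected_induce_iff) auto
    ultimately show False using max by blast
  qed
  ultimately show "K \<in> {K. fin.is_comp K S}" using sub(1) by (simp add: fin.is_comp_def)
next
  fix K assume "K \<in> {K. fin.is_comp K S}"
  then have K: "K \<subseteq> S" "fin.conn K" "fin.closed_in K S" by (auto simp: fin.is_comp_def)
  have "G \<restriction> K \<in> components (G \<restriction> S)"
    unfolding components_def mem_Collect_eq pre_digraph.max_subgraph_def
  proof (intro conjI allI impI notI)
    show "subgraph (G \<restriction> K) (G \<restriction> S)"
      using K(1) by (auto simp: subgraph_def compatible_def)
    show "Digraph_Component.connected (G \<restriction> K)" using K S by (subst connected_induce_iff) auto
    fix H assume H: "H \<noteq> G \<restriction> K \<and> subgraph (G \<restriction> K) H"
      "subgraph H (G \<restriction> S) \<and> Digraph_Component.connected H"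
    have th: "tail H = tail G" "head H = head G" and wf: "wf_digraph H"
      and sub: "K \<subseteq> verts H" "verts H \<subseteq> S" "arcs (G \<restriction> K) \<subseteq> arcs H" "arcs H \<subseteq> arcs (G \<restriction> S)"
      using H by (auto simp: subgraph_def compatible_def)
    have ends: "arcs_ends H \<subseteq> arcs_ends G \<inter> S \<times> S"
      using sub th by (auto simp: arcs_ends_def arc_to_ends_def)
    have "v \<in> K" if "u \<in> K" "(u, v) \<in> arcs_ends H \<or> (v, u) \<in> arcs_ends H" for u v
    proof -
      have "(u, v) \<in> arcs_ends G" "v \<in> S" using that(2) ends fin.E_sym by auto
      then show ?thesis using that(1) K(3) by (auto simp: fin.closed_in_def)
    qed
    then have v: "K = verts H"
      using connected_closed_eq[OF wf _ sub(1) fin.conn_ne[OF K(2)]] H(2) by blast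
    have "arcs H \<subseteq> arcs (G \<restriction> K)"
    proof
      fix e assume e: "e \<in> arcs H"
      then show "e \<in> arcs (G \<restriction> K)"
        using sub(4) wf_digraph.tail_in_verts[OF wf e] wf_digraph.head_in_verts[OF wf e] v th by auto
    qed
    then have "H = G \<restriction> K"
      using sub v th by (intro pre_digraph.equality) auto
    then show False using H(1) by simp
  qed
  then show "K \<in> verts ` components (G \<restriction> S)" by (intro image_eqI[of _ _ "G \<restriction> K"]) auto
qed

lemma weighted_safe_set_iff: "weighted_safe_set G w S \<longleftrightarrow> fin.safe w S"
proof (cases "S \<subseteq> verts G")
  case True
  have "weighted_safe_set G w S \<longleftrightarrow> S \<noteq> {} \<and> S \<subseteq> verts G \<and>
    (\<forall>K \<in> verts ` components (G \<restriction> S). \<forall>L \<in> verts ` components (G \<restriction> (verts G - S)).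
      (\<exists>u \<in> K. \<exists>v \<in> L. u \<rightarrow> v) \<longrightarrow> sum w L \<le> sum w K)"
    by (auto simp: weighted_safe_set_def)
  also have "\<dots> \<longleftrightarrow> fin.safe w S"
    unfolding verts_components_induce[OF True] verts_components_induce[OF Diff_subset] fin.safe_def
    by auto
  finally show ?thesis .
qed (auto simp: weighted_safe_set_def fin.safe_def)

text \<open>\<open>T\<close> attains the minimum over connected safe sets; as the two minima agree,
  it is no heavier than \<open>S\<close>.\<close>

lemma cs_fin_graph_of_cs_graph:
  assumes conn: "Digraph_Component.connected G" and cs: "G \<in> cs_graphs"
  shows "cs_fin_graph (verts G) (arcs_ends G)"
proof
  have G: "G \<restriction> verts G = G"
    by (rule pre_digraph.equality) (auto simp: induce_subgraph_def)
  show conn_V: "fin.conn (verts G)"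
    using connected_induce_iff[of "verts G"] conn G by simp
  fix w :: "'a \<Rightarrow> real" and S
  assume pos: "\<And>v. v \<in> verts G \<Longrightarrow> 0 < w v" and S: "fin.safe w S"
  let ?C = "{T. connected_weighted_safe_set G w T}"
  have eq: "safe_number G w = connected_safe_number G w"
    using cs pos by (auto simp: cs_graphs_def weight_function_def)
  have "safe_number G w \<le> sum w S"
    unfolding safe_number_def
  proof (rule Min_le)
    show "finite (sum w ` {S. weighted_safe_set G w S})"
      using finite_weighted_safe_sets(1)[OF graph_axioms] by (rule finite_imageI)
  qed (use S weighted_safe_set_iff in blast)
  moreover have "connected_safe_number G w \<in> sum w ` ?C"
    unfolding connected_safe_number_def
  proof (rule Min_in)
    show "finite (sum w ` ?C)"
      using finite_weighted_safe_sets(2)[OF graph_axioms] by (rule finite_imageI)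
  qed (use connected_weighted_safe_set_verts[OF graph_axioms conn, of w] in blast)
  ultimately obtain T where T: "connected_weighted_safe_set G w T" "sum w T \<le> sum w S"
    using eq by auto
  have safe: "fin.safe w T" and TV: "T \<subseteq> verts G" "T \<noteq> {}"
    using T(1) by (auto simp: connected_weighted_safe_set_def weighted_safe_set_iff fin.safe_def)
  have connT: "fin.conn T"
    using T(1) connected_induce_iff[OF TV(1)] by (simp add: connected_weighted_safe_set_def)
  have "sum w L \<le> sum w T" if L: "L \<subseteq> verts G - T" "fin.conn L" for L
  proof -
    obtain l where l: "l \<in> L" using fin.conn_ne[OF L(2)] by auto
    then obtain D where D: "l \<in> D" "fin.is_comp D (verts G - T)"
      using fin.comp_exists[of l "verts G - T"] L(1) by auto
    have DV: "D \<subseteq> verts G - T" "fin.closed_in D (verts G - T)"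
      using D(2) by (auto simp: fin.is_comp_def)
    have "L \<subseteq> D" using fin.conn_subset_closed[OF L(2) DV(2) L(1)] l D(1) by auto
    \<comment> \<open>Connectedness of the graph gives an edge from \<open>D\<close> to
      \<open>T\<close>, and \<open>T\<close> is itself a component of the graph induced on
      \<open>T\<close>, so safety compares the two.\<close>
    have "\<not> fin.closed_in D (verts G)"
      using fin.conn_closed_eq[OF conn_V, of D] DV(1) D(1) TV by auto
    then obtain d v where dv: "d \<in> D" "v \<in> verts G" "v \<notin> D" "(d, v) \<in> arcs_ends G"
      by (auto simp: fin.closed_in_def)
    then have "v \<in> T" using DV(2) by (auto simp: fin.closed_in_def)
    moreover have "(v, d) \<in> arcs_ends G" using dv(4) by (rule graph_symmetric)
    moreover have "fin.is_comp T T" using connT by (auto simp: fin.is_comp_def fin.closed_in_def)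
    ultimately have "sum w D \<le> sum w T"
      using safe D(2) dv(1) unfolding fin.safe_def by blast
    moreover have "sum w L \<le> sum w D"
      using \<open>L \<subseteq> D\<close> DV(1) pos finite_subset[of D "verts G"]
      by (intro sum_mono2) (auto intro: less_imp_le)
    ultimately show ?thesis by simp
  qed
  then show "\<exists>T \<subseteq> verts G. fin.conn T \<and> sum w T \<le> sum w S \<and>
      (\<forall>L \<subseteq> verts G - T. fin.conn L \<longrightarrow> sum w L \<le> sum w T)"
    using T(2) TV(1) connT by blast
qed

section \<open>Distance and short walks\<close>

lemma graph_dist_le_of_awalk:
  assumes "awalk u p v" "length p \<le> 3"
  shows "graph_dist G u v \<le> 3"
proof -
  have "awalk_cost (\<lambda>_. 1) p = real (length p)" by (induction p) auto
  then have "graph_dist G u v \<le> ereal (real (length p))"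
    unfolding graph_dist_def using min_cost_le_walk_cost[OF assms(1), of "\<lambda>_. 1"] by simp
  also have "\<dots> \<le> ereal (real 3)" using assms(2) by simp
  finally show ?thesis by simp
qed

lemma awalk_ball:
  assumes "awalk u p v" "z \<in> fin.ball v"
  shows "\<exists>q. awalk u q z \<and> length q \<le> Suc (length p)"
proof (cases "z = v")
  case False
  then have "(v, z) \<in> arcs_ends G" using assms(2) by (auto simp: fin.ball_def fin.nbh_def)
  then obtain e where "e \<in> arcs G" "tail G e = v" "head G e = z"
    by (auto simp: arcs_ends_def arc_to_ends_def)
  then have "awalk u (p @ [e]) z"
    using assms(1) by (intro awalk_appendI[of _ _ v]) (auto simp: awalk_Cons_iff awalk_Nil_iff)
  then show ?thesis by (intro exI[of _ "p @ [e]"]) auto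
qed (use assms(1) in auto)

text \<open>Otherwise \<open>a\<close>, \<open>u\<close>, \<open>v\<close>, \<open>e\<close> would
  be a walk with at most three arcs. Taking each step inside a \<open>ball\<close> covers coinciding
  consecutive vertices.\<close>

lemma far_of_graph_dist:
  assumes "a \<in> verts G" "\<not> graph_dist G a e \<le> 3" "u \<in> fin.ball a" "v \<in> fin.ball e"
  shows "u \<noteq> v \<and> (u, v) \<notin> arcs_ends G"
proof (rule ccontr)
  assume "\<not> (u \<noteq> v \<and> (u, v) \<notin> arcs_ends G)"
  then have vu: "v \<in> fin.ball u" by (auto simp: fin.ball_def fin.nbh_def)
  have ev: "e \<in> fin.ball v"
    using assms(4) fin.E_sym[of e v] by (auto simp: fin.ball_def fin.nbh_def)
  have w0: "awalk a [] a" using assms(1) by (simp add: awalk_Nil_iff)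
  obtain p where p: "awalk a p u" "length p \<le> Suc (length ([] :: 'b list))"
    using awalk_ball[OF w0 assms(3)] by blast
  obtain q where q: "awalk a q v" "length q \<le> Suc (length p)"
    using awalk_ball[OF p(1) vu] by blast
  obtain r where r: "awalk a r e" "length r \<le> Suc (length q)"
    using awalk_ball[OF q(1) ev] by blast
  have "length r \<le> 3" using p(2) q(2) r(2) by simp
  then show False using graph_dist_le_of_awalk[OF r(1)] assms(2) by blast
qed

end

theorem theorem1p4:
  fixes G :: "('a, 'b) pre_digraph"
  assumes "graph G"
    and "Digraph_Component.connected G"
    and "triangle_free G"
    and "G \<in> cs_graphs"
    and "\<not> is_cycle_graph G"
  shows "diam G \<le> 3"
proof -
  interpret graph G by fact
  have "(z, x) \<notin> arcs_ends G" if "(x, y) \<in> arcs_ends G" "(y, z) \<in> arcs_ends G" for x y z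
    using assms(3) that unfolding triangle_free_def by blast
  then interpret T: triangle_free_cs_graph "verts G" "arcs_ends G"
    by (intro triangle_free_cs_graph.intro cs_fin_graph_of_cs_graph[OF assms(2,4)]
        triangle_free_cs_graph_axioms.intro)
  show ?thesis
    unfolding diam_def
  proof (intro SUP_least, rule ccontr)
    fix a e assume ae: "a \<in> verts G" "e \<in> verts G" "\<not> graph_dist G a e \<le> 3"
    have "is_cycle_graph G"
      unfolding is_cycle_graph_def
      using ae(1,2) far_of_graph_dist[OF ae(1,3)] by (rule T.far_vertices_imp_cycle)
    then show False using assms(5) by simp
  qed
qed

end
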